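(* (a) For $2\le p\leq 4$, every geodesically antipodal pair $(U,V)$ in $SO(p)\times SO(p)$ is sign-change reducible. (b) For every $p\geq 11$, there exist geodesically antipodal pairs $(U,V)$ in $SO(p)\times SO(p)$ that are not sign-change reducible.
   Context: $SO(p)$ carries the bi-invariant Riemannian metric given at the identity by $g_{SO}(A_1,A_2)=-\frac12\mathrm{tr}(A_1A_2)$, $A_1,A_2\in\mathfrak{so}(p)$, with geodesic distance $d_{SO}$; thus $d_{SO}(U,V)=\min\{\frac{1}{\sqrt2}\|A\|_F : A\in\mathfrak{so}(p),\ \exp(A)=U^{-1}V\}$ with $\|\cdot\|_F$ the Frobenius norm. A pair $(U,V)\in SO(p)\times SO(p)$ is geodesically antipodal if one point is in the cut-locus of the other, equivalently if $V^{-1}U$ is an involution ($R^2=I\neq R$). $\mathcal{I}_p^+$ is the group of even sign-change matrices: for $\sigma=(\sigma_1,\dots,\sigma_p)\in\{\pm1\}^p$ with $\prod_i\sigma_i=1$, $I_\sigma=\mathrm{diag}(\sigma_1,\dots,\sigma_p)\in SO(p)$. A pair $(U,V)$ is sign-change reducible if $d_{SO}(UI_\sigma,V)<d_{SO}(U,V)$ for some $\sigma\in\mathcal{I}_p^+$. Throughout, $p\ge2$. *)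

theory Defs
  imports "HOL-Analysis.Analysis"
begin

text \<open>The group \<open>SO(p)\<close> is indexed by a finite type \<open>'p\<close>, with \<open>p = CARD('p)\<close>.\<close>

definition SO :: "(real^'p^'p) set" where
  "SO = {U. orthogonal_matrix U \<and> det U = 1}"

definition so :: "(real^'p^'p) set" where
  "so = {A. transpose A = - A}"

text \<open>The type \<open>real^'p^'p\<close> is not an instance of the class of normed algebras (its \<open>*\<close> is
  entrywise), so the library's \<open>exp\<close> is not available for matrices.\<close>

definition matrix_exp :: "real^'p^'p \<Rightarrow> real^'p^'p" where
  "matrix_exp A = (\<Sum>k. (1 / fact k) *\<^sub>R (((\<lambda>B. A ** B) ^^ k) (mat 1)))"

definition g_SO :: "real^'p^'p \<Rightarrow> real^'p^'p \<Rightarrow> real" where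
  "g_SO A B = - (1/2) * trace (A ** B)"

text \<open>The norm of \<open>real^'p^'p\<close> in the library is the Frobenius norm, so on \<open>so\<close> the Riemannian norm
  is \<open>norm A / sqrt 2\<close>.\<close>

lemma sqrt_g_SO:
  fixes A :: "real^'p^'p"
  assumes "A \<in> so"
  shows "sqrt (g_SO A A) = 1 / sqrt 2 * norm A"
proof -
  have sk: "A $ j $ i = - A $ i $ j" for i j
  proof -
    have "transpose A $ i $ j = (- A) $ i $ j"
      using assms unfolding so_def by (elim CollectE) (rule arg_cong)
    then show ?thesis unfolding transpose_def by simp
  qed
  have "A $ i $ j * A $ j $ i = - (A $ i $ j)\<^sup>2" for i j
    by (simp only: sk[of j i] power2_eq_square)
  then have "g_SO A A = (1/2) * (\<Sum>i\<in>UNIV. \<Sum>j\<in>UNIV. (A $ i $ j)\<^sup>2)"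
    unfolding g_SO_def trace_def matrix_matrix_mult_def
    by (simp add: sum_negf)
  also have "(\<Sum>i\<in>UNIV. \<Sum>j\<in>UNIV. (A $ i $ j)\<^sup>2) = (norm A)\<^sup>2"
    unfolding power2_norm_eq_inner by (simp add: inner_vec_def power2_eq_square)
  finally have "g_SO A A = (norm A)\<^sup>2 / 2" by simp
  then show ?thesis
    by (simp only: real_sqrt_divide) simp
qed

text \<open>The infimum is a minimum for \<open>U, V \<in> SO\<close>: the exponential map is continuous and maps the closed
  set \<open>so\<close> onto \<open>SO\<close>.\<close>

definition d_SO :: "real^'p^'p \<Rightarrow> real^'p^'p \<Rightarrow> real" where
  "d_SO U V = Inf {1 / sqrt 2 * norm A | A. A \<in> so \<and> matrix_exp A = matrix_inv U ** V}"

text \<open>The geodesics of a bi-invariant metric starting at \<open>U\<close> are \<open>t \<mapsto> U exp(tA)\<close> with \<open>A \<in> so\<close>.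
  A point is in the cut locus of \<open>U\<close> if it is the last point up to which some geodesic starting
  at \<open>U\<close> is minimizing; rescaling \<open>A\<close>, that point is reached at time 1.\<close>

definition cut_locus :: "real^'p^'p \<Rightarrow> (real^'p^'p) set" where
  "cut_locus U = {U ** matrix_exp A | A. A \<in> so \<and>
     d_SO U (U ** matrix_exp A) = 1 / sqrt 2 * norm A \<and>
     (\<forall>t>1. d_SO U (U ** matrix_exp (t *\<^sub>R A)) < t * (1 / sqrt 2 * norm A))}"

definition geodesically_antipodal :: "real^'p^'p \<Rightarrow> real^'p^'p \<Rightarrow> bool" where
  "geodesically_antipodal U V \<longleftrightarrow> V \<in> cut_locus U \<or> U \<in> cut_locus V"

definition involution :: "real^'p^'p \<Rightarrow> bool" where
  "involution R \<longleftrightarrow> R ** R = mat 1 \<and> R \<noteq> mat 1"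

definition even_signs :: "('p::finite \<Rightarrow> real) set" where
  "even_signs = {\<sigma>. (\<forall>i. \<sigma> i \<in> {1, -1}) \<and> (\<Prod>i\<in>UNIV. \<sigma> i) = 1}"

definition sign_change_matrix :: "('p::finite \<Rightarrow> real) \<Rightarrow> real^'p^'p" where
  "sign_change_matrix \<sigma> = (\<chi> i j. if i = j then \<sigma> i else 0)"

definition sign_change_reducible :: "real^'p^'p \<Rightarrow> real^'p^'p \<Rightarrow> bool" where
  "sign_change_reducible U V \<longleftrightarrow>
     (\<exists>\<sigma>\<in>even_signs. d_SO (U ** sign_change_matrix \<sigma>) V < d_SO U V)"

text \<open>A pair \<open>(U, V)\<close> is called geodesically antipodal if one point is in the cut locus of the other,
  and this is commonly also expressed by saying that \<open>V\<^sup>-\<^sup>1U\<close> is an involution. The two conditions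
  agree for \<open>p \<le> 3\<close>, but for \<open>p \<ge> 4\<close> the cut locus of the identity, which consists of the rotations
  with eigenvalue \<open>-1\<close>, also contains rotations that are not involutions. Results about antipodal pairs
  are therefore stated so as to hold for either description: a universal claim assumes only one of the
  two conditions, an existential claim provides both.\<close>

end

theory Submission
  imports Defs
begin

text \<open>For \<open>U, V\<close> in \<open>SO(p)\<close> everything depends on \<open>W = U\<^sup>-\<^sup>1V\<close>, and the whole argument rests on
  one formula: over all orthonormal bases \<open>x\<close>, the number
  \<open>sqrt (1/2 * (\<Sum>j. arccos\<^sup>2 (x j \<bullet> W x j)))\<close> has the maximum \<open>d_SO U V\<close>.
  That no basis gives more (\<open>d_SO_ge_arccos\<close>) holds because a logarithm \<open>A\<close> of \<open>W\<close> moves a unit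
  vector \<open>x\<close> along a path on the sphere of length \<open>|Ax|\<close>, which is at least the angle from \<open>x\<close>
  to \<open>Wx\<close>; here this is proved by Jensen's inequality for the convex function \<open>arccos\<^sup>2\<close>
  (\<open>arccos_mean_le\<close>), and the squares of the \<open>|A x j|\<close> add up to \<open>|A|\<^sup>2\<close>. The maximum is attained
  at an eigenbasis of the symmetric part of \<open>W\<close>, from which a logarithm is
  written down (\<open>SO_logarithm\<close>).

  Part (a). Antipodal pairs have distance at least \<open>\<pi>\<close>. If \<open>V\<^sup>-\<^sup>1U\<close> is an involution, it has the
  eigenvalue \<open>-1\<close>; and a point nearer than \<open>\<pi>\<close> is not in the cut locus because every geodesic
  is minimizing up to length \<open>\<pi>\<close> (\<open>d_SO_exp\<close>). On the other hand, the chord inequality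
  \<open>arccos\<^sup>2 c \<le> \<pi>\<^sup>2/2 (1 - c)\<close> turns the formula into \<open>d\<^sup>2 \<le> \<pi>\<^sup>2/4 (p - tr W)\<close>. Hence the distance is
  less than \<open>\<pi>\<close> as soon as \<open>p - tr W < 4\<close>, and also if \<open>p - tr W = 4\<close> unless \<open>W\<close> is symmetric
  (\<open>d_SO_less_pi\<close>). For \<open>p \<le> 4\<close> an averaging argument over the signs shows that some
  \<open>I\<^sub>\<sigma>W\<close> satisfies this (\<open>sign_change_small_defect\<close>).

  Part (b). Take \<open>U = I\<close> and let \<open>V\<close> be the half turn of a plane all of whose coordinate
  projections have the same length, so that the projection onto it has all diagonal entries \<open>2/p\<close>.
  The distance is \<open>\<pi>\<close>. If \<open>\<sigma>\<close> has \<open>2m > 0\<close> negative signs, then \<open>W = I\<^sub>\<sigma>V\<close> fixes a subspace of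
  codimension at most \<open>2m + 2\<close> and \<open>p - tr W = 4 + 4m - 16m/p\<close>. Bounding \<open>arccos\<^sup>2\<close> below by a
  tangent line on the remaining \<open>2m + 2\<close> basis vectors gives a distance of at least \<open>\<pi>\<close>
  for all \<open>m\<close> when \<open>p \<ge> 11\<close> (\<open>d_SO_sign_change_half_turn_ge_pi\<close>). The critical case is \<open>m = 1\<close>,
  where by convexity the minimum is attained at two equal angles \<open>arccos (-1 + 4/p)\<close>, and these
  exceed \<open>\<pi>/\<surd>2\<close> exactly from \<open>p = 11\<close> on.\<close>

section \<open>Orthonormal bases and symmetric matrices\<close>

definition onb :: "('p::finite \<Rightarrow> real^'p) \<Rightarrow> bool" where
  "onb x \<longleftrightarrow> (\<forall>i j. x i \<bullet> x j = (if i = j then 1 else 0))"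

lemma onb_inner: "onb x \<Longrightarrow> x i \<bullet> x j = (if i = j then 1 else 0)"
  by (simp add: onb_def)

lemma onb_norm: "onb x \<Longrightarrow> norm (x i) = 1"
  by (simp add: norm_eq_1 onb_def)

lemma inner_matrix_vector:
  fixes M :: "real^'n^'m"
  shows "v \<bullet> (M *v w) = (transpose M *v v) \<bullet> w"
  by (metis dot_lmul_matrix vector_transpose_matrix transpose_transpose)

lemma minus_matrix_vector: "(- A) *v v = - (A *v (v :: real^'n))"
  by (simp add: vec_eq_iff matrix_vector_mult_def sum_negf)

lemma matrix_vector_minus: "A *v (- v) = - (A *v (v :: real^'n))"
  by (simp add: vec_eq_iff matrix_vector_mult_def sum_negf)

lemma onb_orthogonal_matrix:
  fixes x :: "'p::finite \<Rightarrow> real^'p"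
  assumes "onb x"
  shows "orthogonal_matrix (\<chi> i. x i)"
proof -
  have "(\<chi> i. x i) ** transpose (\<chi> i. x i) = (mat 1 :: real^'p^'p)"
    using assms
    by (simp add: vec_eq_iff matrix_matrix_mult_def transpose_def mat_def onb_def inner_vec_def)
  then show ?thesis
    using orthogonal_matrix_def matrix_left_right_inverse by blast
qed

lemma onb_expand:
  assumes "onb x"
  shows "(\<Sum>j\<in>UNIV. (x j \<bullet> v) *\<^sub>R x j) = v"
proof -
  let ?Q = "\<chi> i. x i"
  have "transpose ?Q *v (?Q *v v) = v"
    using onb_orthogonal_matrix[OF assms]
    by (simp add: matrix_vector_mul_assoc orthogonal_matrix_def)
  moreover have "transpose ?Q *v (?Q *v v) = (\<Sum>j\<in>UNIV. (x j \<bullet> v) *\<^sub>R x j)"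
    by (simp add: vec_eq_iff matrix_vector_mult_def transpose_def inner_vec_def mult.commute)
  ultimately show ?thesis by simp
qed

lemma onb_eqI:
  assumes "onb x" "\<And>j. x j \<bullet> v = x j \<bullet> w"
  shows "v = w"
proof -
  have "(\<Sum>j\<in>UNIV. (x j \<bullet> v) *\<^sub>R x j) = (\<Sum>j\<in>UNIV. (x j \<bullet> w) *\<^sub>R x j)"
    by (simp only: assms(2))
  then show ?thesis by (simp only: onb_expand[OF assms(1)])
qed

lemma onb_parseval:
  assumes "onb x"
  shows "v \<bullet> w = (\<Sum>j\<in>UNIV. (x j \<bullet> v) * (x j \<bullet> w))"
proof -
  have "v \<bullet> w = (\<Sum>j\<in>UNIV. (x j \<bullet> v) *\<^sub>R x j) \<bullet> w"
    by (simp add: onb_expand[OF assms])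
  then show ?thesis by (simp add: inner_sum_left)
qed

lemma onb_norm_squared:
  assumes "onb x"
  shows "(norm v)\<^sup>2 = (\<Sum>j\<in>UNIV. (x j \<bullet> v)\<^sup>2)"
  unfolding power2_norm_eq_inner onb_parseval[OF assms, of v v] by (simp add: power2_eq_square)

lemma onb_matrix_vector:
  fixes M :: "real^'p^'m"
  assumes "onb x"
  shows "M *v v = (\<Sum>j\<in>UNIV. (x j \<bullet> v) *\<^sub>R (M *v x j))"
proof -
  have "M *v v = M *v (\<Sum>j\<in>UNIV. (x j \<bullet> v) *\<^sub>R x j)"
    by (simp add: onb_expand[OF assms])
  then show ?thesis
    by (simp add: linear_sum[OF matrix_vector_mul_linear] matrix_vector_mult_scaleR)
qed

lemma onb_matrix_eqI:
  fixes M N :: "real^'p^'m"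
  assumes "onb x" "\<And>j. M *v x j = N *v x j"
  shows "M = N"
proof -
  have "M *v v = N *v v" for v
    by (simp only: onb_matrix_vector[OF assms(1), of M v] onb_matrix_vector[OF assms(1), of N v] assms(2))
  then show ?thesis by (simp add: matrix_eq)
qed

lemma onb_axis: "onb (\<lambda>i. axis i 1)"
  by (simp add: onb_def inner_axis_axis)

lemma matrix_norm_squared:
  fixes A :: "real^'n^'m"
  shows "(norm A)\<^sup>2 = (\<Sum>i\<in>UNIV. \<Sum>j\<in>UNIV. (A $ i $ j)\<^sup>2)"
  unfolding power2_norm_eq_inner by (simp add: inner_vec_def power2_eq_square)

text \<open>Both sides add up the squares of the coordinates, with respect to \<open>x\<close>, of the rows of \<open>A\<close>, in
  different orders.\<close>

lemma onb_frobenius: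
  fixes A :: "real^'p^'p"
  assumes "onb x"
  shows "(norm A)\<^sup>2 = (\<Sum>j\<in>UNIV. (norm (A *v x j))\<^sup>2)"
proof -
  have "(norm A)\<^sup>2 = (\<Sum>i\<in>UNIV. (norm (A $ i))\<^sup>2)"
    unfolding matrix_norm_squared norm_vec_def L2_set_def by (simp add: sum_nonneg)
  also have "\<dots> = (\<Sum>i\<in>UNIV. \<Sum>j\<in>UNIV. (x j \<bullet> A $ i)\<^sup>2)"
    by (simp add: onb_norm_squared[OF assms])
  also have "\<dots> = (\<Sum>j\<in>UNIV. \<Sum>i\<in>UNIV. (x j \<bullet> A $ i)\<^sup>2)" by (rule sum.swap)
  also have "\<dots> = (\<Sum>j\<in>UNIV. (norm (A *v x j))\<^sup>2)"
    unfolding norm_vec_def L2_set_def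
    by (simp add: sum_nonneg matrix_vector_mul_component inner_commute)
  finally show ?thesis .
qed

text \<open>The left-hand side is the trace of \<open>M\<close> conjugated by the orthogonal matrix whose rows are the \<open>x j\<close>.\<close>

lemma onb_trace:
  fixes M :: "real^'p^'p"
  assumes "onb x"
  shows "trace M = (\<Sum>j\<in>UNIV. x j \<bullet> (M *v x j))"
proof -
  let ?Q = "\<chi> i. x i"
  have o: "transpose ?Q ** ?Q = mat 1"
    using onb_orthogonal_matrix[OF assms] by (simp add: orthogonal_matrix_def)
  have "(\<Sum>j\<in>UNIV. x j \<bullet> (M *v x j)) = trace (?Q ** (M ** transpose ?Q))"
    by (simp add: trace_def matrix_matrix_mult_def inner_vec_def matrix_vector_mult_def transpose_def)
  also have "\<dots> = trace (M ** (transpose ?Q ** ?Q))"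
    by (subst trace_mul_sym) (simp add: matrix_mul_assoc)
  finally show ?thesis by (simp add: o)
qed

lemma onb_matrix_exists:
  fixes x y :: "'p::finite \<Rightarrow> real^'p"
  assumes "onb x"
  obtains A :: "real^'p^'p" where "\<And>j. A *v x j = y j"
proof -
  let ?f = "\<lambda>v. \<Sum>j\<in>UNIV. (x j \<bullet> v) *\<^sub>R y j"
  have "linear ?f"
    by (rule linearI) (simp_all add: inner_add_right scaleR_add_left sum.distrib scaleR_sum_right)
  then have "matrix ?f *v x j = ?f (x j)" for j
    by (simp add: matrix_works linear_matrix_vector_mul_eq[symmetric])
  moreover have "?f (x j) = y j" for j
  proof -
    have "(x i \<bullet> x j) *\<^sub>R y i = (if i = j then y i else 0)" for i
      by (simp add: onb_inner[OF assms])
    then show ?thesis by simp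
  qed
  ultimately show ?thesis using that[of "matrix ?f"] by simp
qed

text \<open>The eigenvector is a maximizer of the Rayleigh quotient on the unit sphere of \<open>V\<close>.\<close>

lemma self_adjoint_eigenvector:
  fixes f :: "'a::euclidean_space \<Rightarrow> 'a"
  assumes f: "linear f" and sym: "\<And>v w. f v \<bullet> w = v \<bullet> f w"
    and V: "subspace V" "f ` V \<subseteq> V" "V \<noteq> {0}"
  obtains x \<mu> where "x \<in> V" "norm x = 1" "f x = \<mu> *\<^sub>R x"
proof -
  let ?S = "V \<inter> sphere 0 1"
  have "compact ?S" using closed_subspace[OF V(1)] by (simp add: closed_Int_compact)
  moreover have "?S \<noteq> {}"
  proof -
    obtain y where y: "y \<in> V" "y \<noteq> 0" using V(1,3) subspace_0 by auto
    then have "y /\<^sub>R norm y \<in> ?S" using V(1) by (simp add: subspace_mul)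
    then show ?thesis by blast
  qed
  moreover have "continuous_on ?S (\<lambda>y. y \<bullet> f y)"
    by (intro continuous_intros linear_continuous_on) (use f linear_conv_bounded_linear in blast)
  ultimately obtain x where x: "x \<in> ?S" and max: "\<And>y. y \<in> ?S \<Longrightarrow> y \<bullet> f y \<le> x \<bullet> f x"
    using continuous_attains_sup[of ?S "\<lambda>y. y \<bullet> f y"] by blast
  define \<mu> where "\<mu> = x \<bullet> f x"
  have xV: "x \<in> V" and nx: "norm x = 1" using x by auto
  have ray: "y \<bullet> f y \<le> \<mu> * (y \<bullet> y)" if y: "y \<in> V" for y
  proof (cases "y = 0")
    case True
    then show ?thesis by simp
  next
    case False
    have "y /\<^sub>R norm y \<in> ?S" using V(1) y False by (simp add: subspace_mul)
    from max[OF this] have "(y \<bullet> f y) / (norm y * norm y) \<le> \<mu>"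
      by (simp add: linear_cmul[OF f] \<mu>_def divide_simps)
    then show ?thesis using False
      by (simp add: pos_divide_le_eq power2_norm_eq_inner[symmetric] power2_eq_square)
  qed
  define w where "w = f x - \<mu> *\<^sub>R x"
  have wV: "w \<in> V"
    unfolding w_def using V xV by (intro subspace_diff subspace_mul) auto
  \<comment> \<open>The form \<open>\<mu>|y|\<^sup>2 - y \<bullet> f y\<close> is nonnegative on \<open>V\<close> and vanishes at \<open>x\<close>, so its derivative there,
    in the direction of the residual \<open>w\<close>, has to vanish.\<close>
  have quad: "0 \<le> t\<^sup>2 * (\<mu> * (w \<bullet> w) - w \<bullet> f w) - 2 * t * (w \<bullet> w)" for t
  proof -
    have "x + t *\<^sub>R w \<in> V" using V(1) xV wV by (intro subspace_add subspace_mul)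
    from ray[OF this]
    have "\<mu> + 2 * t * (w \<bullet> f x) + t\<^sup>2 * (w \<bullet> f w) \<le> \<mu> * (1 + 2 * t * (w \<bullet> x) + t\<^sup>2 * (w \<bullet> w))"
      using nx sym[of x w]
      by (simp add: linear_add[OF f] linear_cmul[OF f] inner_add_left inner_add_right
          \<mu>_def[symmetric] norm_eq_1 inner_commute[of x w] inner_commute[of "f x" w] power2_eq_square algebra_simps)
    moreover have "w \<bullet> f x - \<mu> * (w \<bullet> x) = w \<bullet> w"
      unfolding w_def by (simp add: inner_diff_right inner_diff_left)
    then have "w \<bullet> f x = w \<bullet> w + \<mu> * (w \<bullet> x)" by simp
    ultimately show ?thesis by (simp add: algebra_simps)
  qed
  have "w \<bullet> w = 0"
  proof (rule ccontr)
    assume "w \<bullet> w \<noteq> 0"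
    then have pos: "w \<bullet> w > 0" by (simp add: order_less_le)
    define c where "c = \<mu> * (w \<bullet> w) - w \<bullet> f w"
    define t where "t = (w \<bullet> w) / (\<bar>c\<bar> + 1)"
    have "t > 0" unfolding t_def using pos by (simp add: add_nonneg_pos)
    have "t * \<bar>c\<bar> < 2 * (w \<bullet> w)"
    proof -
      have "t * \<bar>c\<bar> \<le> t * (\<bar>c\<bar> + 1)" using \<open>t > 0\<close> by simp
      also have "\<dots> = w \<bullet> w" by (simp add: t_def add_nonneg_eq_0_iff)
      finally show ?thesis using pos by linarith
    qed
    then have "t * c < 2 * (w \<bullet> w)"
      using \<open>t > 0\<close> by (smt (verit) mult_left_mono)
    then have "t * (t * c) < t * (2 * (w \<bullet> w))" using \<open>t > 0\<close> by simp
    then show False using quad[of t] by (simp add: c_def power2_eq_square algebra_simps)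
  qed
  then have "f x = \<mu> *\<^sub>R x" by (simp add: w_def)
  then show ?thesis using that xV nx by blast
qed

text \<open>The spectral theorem. Orthonormal eigenvectors are collected one at a time: the orthogonal complement
  of those already found is invariant, hence contains another one.\<close>

lemma symmetric_matrix_onb:
  fixes S :: "real^'p^'p"
  assumes "transpose S = S"
  obtains x \<mu> where "onb x" "\<And>j. S *v x j = \<mu> j *\<^sub>R x j"
proof -
  have sym: "(S *v v) \<bullet> w = v \<bullet> (S *v w)" for v w
    by (simp add: inner_matrix_vector assms)
  have "\<exists>B. finite B \<and> card B = n \<and> pairwise orthogonal B \<and>
      (\<forall>b\<in>B. norm b = 1 \<and> (\<exists>\<mu>. S *v b = \<mu> *\<^sub>R b))" if "n \<le> CARD('p)" for n
    using that
  proof (induction n)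
    case 0
    show ?case by (intro exI[of _ "{}"]) simp
  next
    case (Suc n)
    then obtain B where B: "finite B" "card B = n" "pairwise orthogonal B"
      "\<And>b. b \<in> B \<Longrightarrow> norm b = 1" "\<And>b. b \<in> B \<Longrightarrow> \<exists>\<mu>. S *v b = \<mu> *\<^sub>R b" by auto
    define V where "V = {v. \<forall>b\<in>B. b \<bullet> v = 0}"
    have "subspace V" by (auto simp: V_def subspace_def inner_add_right)
    moreover have "((*v) S) ` V \<subseteq> V"
    proof (clarsimp simp: V_def)
      fix v b assume v: "\<forall>b\<in>B. b \<bullet> v = 0" and b: "b \<in> B"
      obtain \<mu> where "S *v b = \<mu> *\<^sub>R b" using B(5)[OF b] by blast
      then show "b \<bullet> (S *v v) = 0" using v b by (simp add: sym[symmetric])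
    qed
    moreover have "V \<noteq> {0}"
    proof -
      have "dim B < DIM(real^'p)" using dim_le_card'[OF B(1)] B(2) Suc.prems by simp
      then obtain y where y: "y \<noteq> 0" "\<And>z. z \<in> span B \<Longrightarrow> orthogonal y z"
        using orthogonal_to_subspace_exists[of B] by blast
      have "y \<in> V" using y(2) span_base by (fastforce simp: V_def orthogonal_def inner_commute)
      then show ?thesis using y(1) by blast
    qed
    ultimately obtain z \<mu> where z: "z \<in> V" "norm z = 1" "S *v z = \<mu> *\<^sub>R z"
      using self_adjoint_eigenvector[OF matrix_vector_mul_linear sym] by metis
    have "z \<notin> B" using z by (auto simp: V_def norm_eq_1)
    moreover have "pairwise orthogonal (insert z B)"
      using B(3) z(1) by (auto simp: pairwise_insert V_def orthogonal_def inner_commute)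
    ultimately show ?case
      using B z by (intro exI[of _ "insert z B"]) auto
  qed
  from this[of "CARD('p)"] obtain B where B: "finite B" "card B = CARD('p)" "pairwise orthogonal B"
    "\<And>b. b \<in> B \<Longrightarrow> norm b = 1" "\<And>b. b \<in> B \<Longrightarrow> \<exists>\<mu>. S *v b = \<mu> *\<^sub>R b" by auto
  then obtain x where x: "bij_betw x (UNIV :: 'p set) B"
    using finite_same_card_bij[of "UNIV :: 'p set" B] by auto
  have xB: "x i \<in> B" for i using x bij_betwE by blast
  have "onb x" unfolding onb_def
  proof (intro allI)
    fix i j
    show "x i \<bullet> x j = (if i = j then 1 else 0)"
    proof (cases "i = j")
      case True
      then show ?thesis using B(4)[OF xB[of i]] by (simp add: norm_eq_1)
    next
      case False
      then have "x i \<noteq> x j" using x by (auto simp: bij_betw_def inj_on_def)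
      then show ?thesis using B(3) xB False by (auto simp: pairwise_def orthogonal_def)
    qed
  qed
  moreover obtain \<mu> where "\<And>j. S *v x j = \<mu> j *\<^sub>R x j" using B(5)[OF xB] by metis
  ultimately show ?thesis using that by blast
qed

section \<open>The exponential of a skew-symmetric matrix\<close>

lemma norm_matrix_vector_le:
  fixes A :: "real^'n^'m"
  shows "norm (A *v v) \<le> norm A * norm v"
proof -
  have "(norm (A *v v))\<^sup>2 = (\<Sum>i\<in>UNIV. (A $ i \<bullet> v)\<^sup>2)"
    unfolding norm_vec_def L2_set_def by (simp add: sum_nonneg matrix_vector_mul_component)
  also have "\<dots> \<le> (\<Sum>i\<in>UNIV. (norm (A $ i))\<^sup>2 * (norm v)\<^sup>2)"
    by (rule sum_mono) (metis Cauchy_Schwarz_ineq power2_norm_eq_inner)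
  also have "\<dots> = (norm A * norm v)\<^sup>2"
    unfolding norm_vec_def[of A] L2_set_def by (simp add: sum_nonneg power_mult_distrib sum_distrib_right)
  finally show ?thesis by (rule power2_le_imp_le) simp
qed

lemma norm_matrix_mult_le:
  fixes A B :: "real^'p^'p"
  shows "norm (A ** B) \<le> norm A * norm B"
proof -
  have "(norm (A ** B))\<^sup>2 = (\<Sum>j\<in>UNIV. (norm (A *v (B *v axis j 1)))\<^sup>2)"
    by (simp add: onb_frobenius[OF onb_axis] matrix_vector_mul_assoc)
  also have "\<dots> \<le> (\<Sum>j\<in>UNIV. (norm A * norm (B *v axis j 1))\<^sup>2)"
    by (intro sum_mono power_mono norm_matrix_vector_le) simp
  also have "\<dots> = (norm A * norm B)\<^sup>2"
    by (simp add: onb_frobenius[OF onb_axis, of B] power_mult_distrib sum_distrib_left)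
  finally show ?thesis by (rule power2_le_imp_le) simp
qed

lemma summable_matrix_exp:
  fixes A :: "real^'p^'p"
  shows "summable (\<lambda>k. (1 / fact k) *\<^sub>R (((\<lambda>B. A ** B) ^^ k) (mat 1)))"
proof (rule summable_comparison_test')
  let ?N = "\<lambda>k. ((\<lambda>B. A ** B) ^^ k) (mat 1 :: real^'p^'p)"
  have N: "norm (?N k) \<le> norm A ^ k * norm (mat 1 :: real^'p^'p)" for k
  proof (induction k)
    case (Suc k)
    have "norm (?N (Suc k)) \<le> norm A * norm (?N k)" by (simp add: norm_matrix_mult_le)
    also have "\<dots> \<le> norm A * (norm A ^ k * norm (mat 1 :: real^'p^'p))"
      using Suc by (intro mult_left_mono) auto
    finally show ?case by simp
  qed simp
  show "norm ((1 / fact k) *\<^sub>R ?N k) \<le> norm (mat 1 :: real^'p^'p) * (inverse (fact k) * norm A ^ k)" for k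
    using N[of k] by (simp add: divide_simps mult.commute)
  show "summable (\<lambda>k. norm (mat 1 :: real^'p^'p) * (inverse (fact k) * norm A ^ k))"
    by (intro summable_mult summable_exp)
qed

definition sinc :: "real \<Rightarrow> real" where
  "sinc t = (if t = 0 then 1 else sin t / t)"

text \<open>The exponential series acts on \<open>span {x, A x}\<close> like a rotation: its even terms add up to the cosine
  series on \<open>x\<close>, its odd terms to the sine series on \<open>A x\<close>. This is all that is used about \<open>matrix_exp\<close>.
  The case \<open>t = 0\<close>, in which \<open>A\<^sup>2x = 0\<close>, is the reason for the function \<open>sinc\<close>.\<close>

lemma matrix_exp_plane:
  fixes A :: "real^'p^'p"
  assumes A2: "A *v (A *v x) = - (t\<^sup>2) *\<^sub>R x"
  shows "matrix_exp A *v x = cos t *\<^sub>R x + sinc t *\<^sub>R (A *v x)"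
proof -
  let ?N = "\<lambda>k. ((\<lambda>B. A ** B) ^^ k) (mat 1 :: real^'p^'p)"
  let ?s = "\<lambda>k. if t = 0 then (if k = 1 then 1 else 0) else sin_coeff k * t ^ k / t"
  have N: "?N k *v x = (- (t\<^sup>2)) ^ (k div 2) *\<^sub>R (if even k then x else A *v x)" for k
  proof (induction k)
    case (Suc k)
    have "?N (Suc k) *v x = A *v (?N k *v x)" by (simp add: matrix_vector_mul_assoc)
    also have "\<dots> = (- (t\<^sup>2)) ^ (k div 2) *\<^sub>R (if even k then A *v x else - (t\<^sup>2) *\<^sub>R x)"
      using A2 by (simp add: Suc matrix_vector_mult_scaleR)
    finally show ?case by (cases "even k") auto
  qed simp
  have bl: "bounded_linear (\<lambda>M :: real^'p^'p. M *v x)"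
    by (simp add: linear_conv_bounded_linear[symmetric] linear_iff matrix_vector_mult_add_rdistrib
        scaleR_matrix_vector_assoc)
  have term_eq: "((1 / fact k) *\<^sub>R ?N k) *v x = (cos_coeff k * t ^ k) *\<^sub>R x + ?s k *\<^sub>R (A *v x)" for k
  proof -
    have T: "((1 / fact k) *\<^sub>R ?N k) *v x
        = ((- (t\<^sup>2)) ^ (k div 2) / fact k) *\<^sub>R (if even k then x else A *v x)"
      unfolding scaleR_matrix_vector_assoc[symmetric] N by simp
    show ?thesis
    proof (cases "even k")
      case True
      then obtain m where k: "k = 2 * m" by blast
      have "(- (t\<^sup>2)) ^ m = (-1) ^ m * t ^ k" by (simp add: k power_mult power_minus[of "t\<^sup>2"])
      moreover have "?s k = 0" by (simp add: k sin_coeff_def)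
      ultimately show ?thesis
        unfolding T by (simp add: k cos_coeff_def)
    next
      case False
      then obtain m where k: "k = 2 * m + 1" using oddE by blast
      have "(- (t\<^sup>2)) ^ m = (-1) ^ m * t ^ (2 * m)" by (simp add: power_mult power_minus[of "t\<^sup>2"])
      then have "(- (t\<^sup>2)) ^ m / fact k = ?s k"
        by (auto simp: k sin_coeff_def power_0_left)
      moreover have "k div 2 = m" "odd k" "cos_coeff k = 0" by (simp_all add: k cos_coeff_def)
      ultimately show ?thesis unfolding T by simp
    qed
  qed
  have c: "(\<lambda>k. cos_coeff k * t ^ k) sums cos t" using cos_converges[of t] by simp
  have s: "?s sums sinc t"
  proof (cases "t = 0")
    case True
    then show ?thesis using sums_single[of 1 "\<lambda>_. 1 :: real"] by (simp add: sinc_def)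
  next
    case False
    then show ?thesis using sums_divide[OF sin_converges[of t], of t] by (simp add: sinc_def)
  qed
  have S: "(\<lambda>k. ((1 / fact k) *\<^sub>R ?N k) *v x) sums (cos t *\<^sub>R x + sinc t *\<^sub>R (A *v x))"
    unfolding term_eq by (intro sums_add sums_scaleR_left c s)
  have E: "matrix_exp A *v x = (\<Sum>k. ((1 / fact k) *\<^sub>R ?N k) *v x)"
    unfolding matrix_exp_def by (rule bounded_linear.suminf[OF bl summable_matrix_exp])
  show ?thesis unfolding E by (rule sums_unique[OF S, symmetric])
qed

lemma so_transpose: "A \<in> so \<Longrightarrow> transpose A = - A"
  by (simp add: so_def)

lemma so_inner:
  assumes "A \<in> so"
  shows "v \<bullet> (A *v w) = - ((A *v v) \<bullet> w)"
  by (simp add: inner_matrix_vector so_transpose[OF assms] minus_matrix_vector del: transpose_matrix_vector)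

lemma so_inner_self: "A \<in> so \<Longrightarrow> v \<bullet> (A *v v) = 0"
  using so_inner[of A v v] by (simp add: inner_commute)

lemma so_scaleR: "A \<in> so \<Longrightarrow> t *\<^sub>R A \<in> so"
  by (simp add: so_def transpose_scalar)

text \<open>The eigenbasis of the symmetric matrix \<open>A\<^sup>2\<close>; skew symmetry makes the eigenvalue at \<open>x j\<close>
  equal to \<open>-|A x j|\<^sup>2\<close>. The numbers \<open>|A x j|\<close> are the rotation angles of \<open>exp A\<close>.\<close>

lemma so_onb:
  fixes A :: "real^'p^'p"
  assumes A: "A \<in> so"
  obtains x where "onb x" "\<And>j. A *v (A *v x j) = - ((norm (A *v x j))\<^sup>2) *\<^sub>R x j"
proof -
  have "transpose (A ** A) = A ** A"
    using so_transpose[OF A] by (simp add: matrix_transpose_mul) (simp add: vec_eq_iff matrix_matrix_mult_def)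
  then obtain x \<mu> where x: "onb x" and \<mu>: "\<And>j. (A ** A) *v x j = \<mu> j *\<^sub>R x j"
    using symmetric_matrix_onb by blast
  have "\<mu> j = - ((norm (A *v x j))\<^sup>2)" for j
  proof -
    have "\<mu> j = x j \<bullet> ((A ** A) *v x j)" using \<mu> onb_inner[OF x] by simp
    also have "\<dots> = - ((A *v x j) \<bullet> (A *v x j))"
      by (simp add: matrix_vector_mul_assoc[symmetric] so_inner[OF A, of "x j"])
    finally show ?thesis by (simp add: power2_norm_eq_inner)
  qed
  then show ?thesis using that[OF x] \<mu> by (simp add: matrix_vector_mul_assoc)
qed

text \<open>Only the even part of the exponential contributes to the quadratic form: the odd part has in the basis
  \<open>x\<close> the entries \<open>sinc (t j) * (x i \<bullet> A x j)\<close>, which are antisymmetric because \<open>A\<close> is skew and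
  maps every eigenspace of \<open>A\<^sup>2\<close> into itself.\<close>

lemma so_exp_inner:
  fixes A :: "real^'p^'p"
  assumes A: "A \<in> so" and x: "onb x" and A2: "\<And>j. A *v (A *v x j) = - ((t j)\<^sup>2) *\<^sub>R x j"
    and t: "\<And>j. 0 \<le> t j"
  shows "y \<bullet> (matrix_exp A *v y) = (\<Sum>j\<in>UNIV. (x j \<bullet> y)\<^sup>2 * cos (t j))"
proof -
  define M where "M i j = (x i \<bullet> (A *v x j)) * sinc (t j)" for i j
  have anti: "M i j = - M j i" for i j
  proof (cases "t i = t j")
    case True
    then show ?thesis by (simp add: M_def so_inner[OF A, of "x i"] inner_commute)
  next
    case False
    have "- ((t i)\<^sup>2) * (x i \<bullet> (A *v x j)) = (A *v (A *v x i)) \<bullet> (A *v x j)" by (simp add: A2)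
    also have "\<dots> = x i \<bullet> (A *v (A *v (A *v x j)))"
      by (simp add: so_inner[OF A, of "x i"] so_inner[OF A, of "A *v x i"])
    also have "\<dots> = - ((t j)\<^sup>2) * (x i \<bullet> (A *v x j))"
      by (subst A2) (simp add: matrix_vector_mult_scaleR matrix_vector_minus)
    finally have "x i \<bullet> (A *v x j) = 0"
      using False t[of i] t[of j] by (simp add: power2_eq_iff_nonneg)
    then show ?thesis by (simp add: M_def so_inner[OF A, of "x j"] inner_commute)
  qed
  have "y \<bullet> (A *v x j) = (\<Sum>i\<in>UNIV. (x i \<bullet> y) * (x i \<bullet> (A *v x j)))" for j
    by (rule onb_parseval[OF x])
  then have "y \<bullet> (matrix_exp A *v x j)
      = (x j \<bullet> y) * cos (t j) + (\<Sum>i\<in>UNIV. (x i \<bullet> y) * M i j)" for j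
    by (simp add: matrix_exp_plane[OF A2] inner_add_right M_def sum_distrib_left inner_commute
        mult.commute mult.left_commute)
  then have "y \<bullet> (matrix_exp A *v y) = (\<Sum>j\<in>UNIV. (x j \<bullet> y) * ((x j \<bullet> y) * cos (t j)))
      + (\<Sum>j\<in>UNIV. \<Sum>i\<in>UNIV. (x j \<bullet> y) * ((x i \<bullet> y) * M i j))"
    by (simp add: onb_matrix_vector[OF x, of _ y] inner_sum_right distrib_left sum.distrib sum_distrib_left)
  moreover have "(\<Sum>j\<in>UNIV. \<Sum>i\<in>UNIV. (x j \<bullet> y) * ((x i \<bullet> y) * M i j)) = 0" (is "?D = 0")
  proof -
    have "?D = (\<Sum>i\<in>UNIV. \<Sum>j\<in>UNIV. (x j \<bullet> y) * ((x i \<bullet> y) * M i j))" by (rule sum.swap)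
    also have "\<dots> = - ?D"
      by (subst anti) (simp add: sum_negf mult.left_commute)
    finally show ?thesis by simp
  qed
  ultimately show ?thesis by (simp add: power2_eq_square mult.assoc)
qed

text \<open>Together with \<open>so_exp_inner\<close> this says that, for a unit vector \<open>y\<close>, both \<open>y \<bullet> exp A y\<close> and \<open>|A y|\<^sup>2\<close>
  are averages, with the same weights \<open>(x j \<bullet> y)\<^sup>2\<close>, of functions of the rotation angles.\<close>

lemma so_norm_expand:
  fixes A :: "real^'p^'p"
  assumes A: "A \<in> so" and x: "onb x" and A2: "\<And>j. A *v (A *v x j) = - ((t j)\<^sup>2) *\<^sub>R x j"
  shows "(norm (A *v y))\<^sup>2 = (\<Sum>j\<in>UNIV. (x j \<bullet> y)\<^sup>2 * (t j)\<^sup>2)"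
proof -
  have "(norm (A *v y))\<^sup>2 = - (y \<bullet> (A *v (A *v y)))"
    by (simp add: power2_norm_eq_inner so_inner[OF A, of y])
  also have "\<dots> = - (y \<bullet> ((A ** A) *v y))" by (simp add: matrix_vector_mul_assoc)
  also have "\<dots> = (\<Sum>j\<in>UNIV. (x j \<bullet> y)\<^sup>2 * (t j)\<^sup>2)"
    by (simp add: onb_matrix_vector[OF x, of _ y] matrix_vector_mul_assoc[symmetric] A2 inner_sum_right
        sum_negf inner_commute power2_eq_square mult_ac)
  finally show ?thesis .
qed

section \<open>Convexity of the squared arc cosine\<close>

text \<open>The function \<open>sin u / u\<close> decreases on \<open>(0, \<pi>]\<close>, since the numerator \<open>u cos u - sin u\<close> of its
  derivative has the derivative \<open>- u sin u\<close>.\<close>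

lemma sin_ratio_strict_antimono:
  fixes s t :: real
  assumes "0 < s" "s < t" "t \<le> pi"
  shows "s * sin t < t * sin s"
proof -
  have k: "u * cos u < sin u" if u: "0 < u" "u \<le> pi" for u :: real
  proof -
    have "\<exists>z>0. z < u \<and> (u * cos u - sin u) - (0 * cos 0 - sin 0) = (u - 0) * (- (z * sin z))"
      by (rule MVT2[OF u(1)]) (auto intro!: derivative_eq_intros)
    then obtain z where z: "0 < z" "z < u" and e: "u * cos u - sin u = - (u * (z * sin z))" by auto
    have "0 < u * (z * sin z)" using z u by (simp add: sin_gt_zero)
    then show ?thesis using e by linarith
  qed
  have "\<exists>y. ((\<lambda>u. sin u / u) has_real_derivative y) (at v) \<and> y < 0" if "s \<le> v" "v \<le> t" for v
    by (rule exI[of _ "(v * cos v - sin v) / (v * v)"])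
      (use k[of v] that assms in \<open>auto intro!: derivative_eq_intros simp: field_simps divide_less_0_iff\<close>)
  from DERIV_neg_imp_decreasing[OF assms(2) this]
  show ?thesis using assms by (simp add: field_simps)
qed

lemma sin_ratio_antimono:
  fixes s t :: real
  assumes "0 < s" "s \<le> t" "t \<le> pi"
  shows "s * sin t \<le> t * sin s"
  using assms sin_ratio_strict_antimono[of s t] by (cases "s = t") auto

text \<open>As a function of \<open>cos s\<close>, the square \<open>s\<^sup>2\<close> is convex on \<open>[0, \<pi>]\<close>; the left-hand side is its tangent
  at \<open>cos t\<close>. Angles beyond \<open>\<pi>\<close>, where \<open>s\<^sup>2\<close> exceeds \<open>arccos\<^sup>2 (cos s)\<close>, are included because
  logarithms that are not the shortest have such angles.\<close>

lemma square_ge_tangent: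
  fixes s t :: real
  assumes t: "0 < t" "t < pi" and s: "0 \<le> s"
  shows "t\<^sup>2 + 2 * t / sin t * (cos t - cos s) \<le> s\<^sup>2"
proof -
  have st: "sin t > 0" using t by (rule sin_gt_zero)
  define h where "h u = sin t * u\<^sup>2 + 2 * t * cos u" for u
  have dh: "(h has_real_derivative 2 * (u * sin t - t * sin u)) (at u)" for u
    unfolding h_def by (auto intro!: derivative_eq_intros)
  have le: "t\<^sup>2 + 2 * t / sin t * (cos t - cos u) \<le> u\<^sup>2" if u: "0 \<le> u" "u \<le> pi" for u
  proof -
    have "h t \<le> h u"
    proof (cases "t \<le> u")
      case True
      then show ?thesis
      proof (rule DERIV_nonneg_imp_nondecreasing)
        fix v assume "t \<le> v" "v \<le> u"
        then show "\<exists>y. (h has_real_derivative y) (at v) \<and> 0 \<le> y"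
          using dh[of v] sin_ratio_antimono[of t v] t u by (intro exI conjI) (assumption, simp)
      qed
    next
      case False
      then have "u \<le> t" by simp
      then show ?thesis
      proof (rule DERIV_nonpos_imp_nonincreasing)
        fix v assume v: "u \<le> v" "v \<le> t"
        have "v * sin t \<le> t * sin v"
          using sin_ratio_antimono[of v t] t u v by (cases "v = 0") auto
        then show "\<exists>y. (h has_real_derivative y) (at v) \<and> y \<le> 0"
          using dh[of v] by (intro exI conjI) (assumption, simp)
      qed
    qed
    then show ?thesis using st by (simp add: h_def field_simps)
  qed
  show ?thesis
  proof (cases "s \<le> pi")
    case True
    then show ?thesis using le s by blast
  next
    case False
    have "2 * t / sin t * (cos t - cos s) \<le> 2 * t / sin t * (cos t - cos pi)"
      using t st by (intro mult_left_mono) auto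
    moreover have "pi\<^sup>2 \<le> s\<^sup>2" using False by (intro power_mono) auto
    ultimately show ?thesis using le[of pi] by simp
  qed
qed

text \<open>Jensen's inequality for \<open>arccos\<^sup>2\<close>, by averaging the tangent inequality at the mean. This needs a mean inside
  \<open>(-1, 1)\<close>: at \<open>-1\<close> the tangent is vertical, and there all cosines with positive weight are \<open>-1\<close>.\<close>

lemma arccos_mean_le:
  fixes w t :: "'i \<Rightarrow> real"
  assumes J: "finite J" and w: "\<And>j. j \<in> J \<Longrightarrow> 0 \<le> w j" "sum w J = 1"
    and t: "\<And>j. j \<in> J \<Longrightarrow> 0 \<le> t j"
  shows "(arccos (\<Sum>j\<in>J. w j * cos (t j)))\<^sup>2 \<le> (\<Sum>j\<in>J. w j * (t j)\<^sup>2)"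
proof -
  define c where "c = (\<Sum>j\<in>J. w j * cos (t j))"
  have "c \<le> (\<Sum>j\<in>J. w j * 1)"
    unfolding c_def by (intro sum_mono mult_left_mono w) auto
  then have c1: "c \<le> 1" using w(2) by simp
  have "(\<Sum>j\<in>J. w j * (-1)) \<le> c"
    unfolding c_def by (intro sum_mono mult_left_mono w) auto
  then have c2: "-1 \<le> c" using w(2) by (simp add: sum_negf)
  consider "c = 1" | "c = -1" | "-1 < c" "c < 1" using c1 c2 by linarith
  then show ?thesis
  proof cases
    case 1
    then show ?thesis using w by (simp add: c_def sum_nonneg)
  next
    case 2
    have "(\<Sum>j\<in>J. w j * (1 + cos (t j))) = 0"
      using 2 w(2) by (simp add: distrib_left sum.distrib c_def)
    moreover have "0 \<le> w j * (1 + cos (t j))" if "j \<in> J" for j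
      using w(1)[OF that] cos_ge_minus_one[of "t j"] by (intro mult_nonneg_nonneg) linarith+
    ultimately have z: "w j * (1 + cos (t j)) = 0" if "j \<in> J" for j
      using sum_nonneg_eq_0_iff[OF J, of "\<lambda>j. w j * (1 + cos (t j))"] that by blast
    have "w j * pi\<^sup>2 \<le> w j * (t j)\<^sup>2" if j: "j \<in> J" for j
    proof (cases "w j = 0")
      case False
      then have "cos (t j) = -1" using z[OF j] by simp
      then have "\<not> t j < pi" using cos_monotone_0_pi[OF t[OF j], of pi] by auto
      then show ?thesis using w(1)[OF j] by (intro mult_left_mono power_mono) auto
    qed simp
    then have "(\<Sum>j\<in>J. w j * pi\<^sup>2) \<le> (\<Sum>j\<in>J. w j * (t j)\<^sup>2)" by (rule sum_mono)
    then show ?thesis using 2 w(2) by (simp add: c_def sum_distrib_right[symmetric])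
  next
    case 3
    define u where "u = arccos c"
    have u: "0 < u" "u < pi" "cos u = c"
      using arccos_lt_bounded[OF 3] 3 by (auto simp: u_def)
    define k where "k = 2 * u / sin u"
    have "u\<^sup>2 = (u\<^sup>2 + k * c) - k * c" by simp
    also have "\<dots> = (\<Sum>j\<in>J. w j * (u\<^sup>2 + k * c) - k * (w j * cos (t j)))"
      unfolding sum_subtractf sum_distrib_right[symmetric] sum_distrib_left[symmetric] w(2) c_def by simp
    also have "\<dots> = (\<Sum>j\<in>J. w j * (u\<^sup>2 + k * (cos u - cos (t j))))"
      by (rule sum.cong) (simp_all add: u(3) algebra_simps)
    also have "\<dots> \<le> (\<Sum>j\<in>J. w j * (t j)\<^sup>2)"
      unfolding k_def by (intro sum_mono mult_left_mono square_ge_tangent u t w)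
    finally show ?thesis by (simp add: u_def c_def)
  qed
qed

section \<open>A lower bound for the norm of a logarithm\<close>

text \<open>The angle between \<open>y\<close> and \<open>exp A y\<close> is at most the length \<open>|A y|\<close> of the curve \<open>exp (t A) y\<close>, \<open>0 \<le> t \<le> 1\<close>,
  on the unit sphere.\<close>

lemma arccos_exp_le:
  fixes A :: "real^'p^'p"
  assumes A: "A \<in> so" and y: "norm y = 1"
  shows "(arccos (y \<bullet> (matrix_exp A *v y)))\<^sup>2 \<le> (norm (A *v y))\<^sup>2"
proof -
  obtain x where x: "onb x" and A2: "\<And>j. A *v (A *v x j) = - ((norm (A *v x j))\<^sup>2) *\<^sub>R x j"
    using so_onb[OF A] by blast
  have "(\<Sum>j\<in>UNIV. (x j \<bullet> y)\<^sup>2) = 1" using onb_norm_squared[OF x, of y] y by simp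
  then show ?thesis
    unfolding so_exp_inner[OF A x A2 norm_ge_zero, of y] so_norm_expand[OF A x A2, of y]
    by (intro arccos_mean_le) auto
qed

lemma so_norm_ge_arccos:
  fixes A :: "real^'p^'p"
  assumes A: "A \<in> so" and y: "onb y"
  shows "(\<Sum>j\<in>UNIV. (arccos (y j \<bullet> (matrix_exp A *v y j)))\<^sup>2) \<le> (norm A)\<^sup>2"
  unfolding onb_frobenius[OF y, of A] by (intro sum_mono arccos_exp_le A onb_norm y)

section \<open>Logarithms of rotations\<close>

lemma det_onb_eigenvectors:
  fixes D :: "real^'p^'p"
  assumes x: "onb x" and D: "\<And>j. D *v x j = d j *\<^sub>R x j"
  shows "det D = (\<Prod>j\<in>UNIV. d j)"
proof -
  let ?Q = "\<chi> i. x i"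
  have Q: "?Q ** transpose ?Q = mat 1"
    using onb_orthogonal_matrix[OF x] by (simp add: orthogonal_matrix_def)
  have "?Q ** (D ** transpose ?Q) = (\<chi> i j. x i \<bullet> (D *v x j))"
    by (simp add: vec_eq_iff matrix_matrix_mult_def inner_vec_def matrix_vector_mult_def transpose_def)
  then have E: "?Q ** (D ** transpose ?Q) = (\<chi> i j. if i = j then d i else 0)"
    by (simp add: vec_eq_iff D onb_inner[OF x])
  have "det D = det D * det (?Q ** transpose ?Q)" by (simp add: Q)
  also have "\<dots> = det (?Q ** (D ** transpose ?Q))" by (simp add: det_mul)
  also have "\<dots> = (\<Prod>j\<in>UNIV. d j)" unfolding E by (subst det_diagonal) simp_all
  finally show ?thesis .
qed

text \<open>The determinant changes sign along the segment from \<open>M\<close> to \<open>N\<close>.\<close>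

lemma singular_segment:
  fixes M N :: "real^'p^'p"
  assumes "det M > 0" "det N < 0"
  obtains t v where "0 \<le> t" "t \<le> 1" "v \<noteq> 0" "(1 - t) *\<^sub>R (M *v v) + t *\<^sub>R (N *v v) = 0"
proof -
  let ?L = "\<lambda>t. (1 - t) *\<^sub>R M + t *\<^sub>R N"
  have "continuous_on {0..1} (\<lambda>t. det (?L t))"
    unfolding det_def by (intro continuous_intros)
  then obtain t where t: "0 \<le> t" "t \<le> 1" "det (?L t) = 0"
    using IVT2'[of "\<lambda>t. det (?L t)" 1 0 0] assms by auto
  then have "\<not> invertible (?L t)" by (simp add: invertible_det_nz)
  then obtain v where v: "v \<noteq> 0" "?L t *v v = 0"
    using matrix_left_invertible_ker[of "?L t"] invertible_left_inverse[of "?L t"] by blast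
  then have "(1 - t) *\<^sub>R (M *v v) + t *\<^sub>R (N *v v) = 0"
    by (simp add: matrix_vector_mult_add_rdistrib scaleR_matrix_vector_assoc)
  then show ?thesis using that t v by blast
qed

lemma orthogonal_norm:
  fixes W :: "real^'p^'p"
  assumes "orthogonal_matrix W"
  shows "norm (W *v v) = norm v"
  using assms orthogonal_transformation_matrix[of "(*v) W"] by (simp add: orthogonal_transformation_norm)

lemma orthogonal_transpose_cancel:
  fixes W :: "real^'p^'p"
  assumes "orthogonal_matrix W"
  shows "transpose W *v (W *v v) = v" "W *v (transpose W *v v) = v"
  using assms unfolding orthogonal_matrix_def matrix_vector_mul_assoc by simp_all

text \<open>The eigenvalues \<open>c j\<close> of the symmetric part \<open>(W + W\<^sup>T)/2\<close> will be the cosines of the rotation angles of \<open>W\<close>.\<close>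

lemma orthogonal_symmetric_part_onb:
  fixes W :: "real^'p^'p"
  obtains x c where "onb x" "\<And>j. W *v x j + transpose W *v x j = (2 * c j) *\<^sub>R x j"
    "\<And>j. c j = x j \<bullet> (W *v x j)"
proof -
  have "transpose (W + transpose W) = W + transpose W"
    by (simp add: vec_eq_iff transpose_def)
  then obtain x \<mu> where x: "onb x" and \<mu>: "\<And>j. (W + transpose W) *v x j = \<mu> j *\<^sub>R x j"
    using symmetric_matrix_onb by blast
  have sum: "W *v x j + transpose W *v x j = \<mu> j *\<^sub>R x j" for j
    using \<mu>[of j] by (simp only: matrix_vector_mult_add_rdistrib)
  have "\<mu> j = 2 * (x j \<bullet> (W *v x j))" for j
  proof -
    have "\<mu> j = x j \<bullet> (\<mu> j *\<^sub>R x j)" using onb_inner[OF x] by simp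
    also have "\<dots> = x j \<bullet> (W *v x j) + x j \<bullet> (transpose W *v x j)"
      unfolding sum[symmetric] by (rule inner_add_right)
    also have "x j \<bullet> (transpose W *v x j) = x j \<bullet> (W *v x j)"
      by (simp only: inner_matrix_vector[of "x j" "transpose W"] transpose_transpose inner_commute)
    finally show ?thesis by simp
  qed
  then show ?thesis using that[of x "\<lambda>j. \<mu> j / 2"] x sum by simp
qed

text \<open>The eigenspace of \<open>W\<close> for \<open>-1\<close> has even dimension. Let \<open>D\<close> be \<open>-1\<close> on it and the identity on its
  complement. If the dimension were odd, then \<open>det D < 0 < det W\<close> and some matrix on the segment from
  \<open>W\<close> to \<open>D\<close> would be singular; by orthogonality only the midpoint can be, and then \<open>D v = - W v\<close>
  for some \<open>v \<noteq> 0\<close>. This is impossible, since \<open>W\<close> and \<open>D\<close> agree on the eigenspace and \<open>W\<close> has no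
  eigenvalue \<open>-1\<close> on the complement.\<close>

lemma SO_even_eigenvalue_minus_one:
  fixes W :: "real^'p^'p"
  assumes W: "W \<in> SO" and x: "onb x"
    and c: "\<And>j. W *v x j + transpose W *v x j = (2 * c j) *\<^sub>R x j"
    and c1: "\<And>j. c j = -1 \<Longrightarrow> W *v x j = - x j"
  shows "even (card {j. c j = -1})"
proof (rule ccontr)
  define M where "M = {j. c j = -1}"
  define d where "d j = (if j \<in> M then -1 else 1 :: real)" for j
  have o: "orthogonal_matrix W" and det: "det W = 1" using W by (auto simp: SO_def)
  assume "odd (card {j. c j = -1})"
  then have "odd (card M)" by (simp add: M_def)
  obtain D :: "real^'p^'p" where D: "\<And>j. D *v x j = d j *\<^sub>R x j"
    using onb_matrix_exists[OF x, of "\<lambda>j. d j *\<^sub>R x j"] by metis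
  have "(\<Prod>j\<in>UNIV. d j) = (\<Prod>j\<in>M. d j) * (\<Prod>j\<in>-M. d j)"
    using prod.union_disjoint[of M "-M" d] by (simp add: Compl_partition)
  also have "\<dots> = (-1) ^ card M" by (simp add: d_def)
  finally have "det D = -1"
    using det_onb_eigenvectors[OF x D] \<open>odd (card M)\<close> by simp
  then obtain t v where t: "0 \<le> t" "t \<le> 1" and v: "v \<noteq> 0"
    and tv: "(1 - t) *\<^sub>R (W *v v) + t *\<^sub>R (D *v v) = 0"
    using singular_segment[of W D] det by auto
  have Dx: "x j \<bullet> (D *v w) = d j * (x j \<bullet> w)" for j w
  proof -
    have "x j \<bullet> (D *v w) = (\<Sum>i\<in>UNIV. (x i \<bullet> w) * (d i * (x j \<bullet> x i)))"
      by (simp add: onb_matrix_vector[OF x, of D w] D inner_sum_right mult.assoc)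
    also have "\<dots> = (\<Sum>i\<in>UNIV. if i = j then d j * (x j \<bullet> w) else 0)"
      by (rule sum.cong) (auto simp: onb_inner[OF x])
    finally show ?thesis by simp
  qed
  have "norm (D *v v) = norm v"
  proof -
    have "(norm (D *v v))\<^sup>2 = (norm v)\<^sup>2"
    proof -
      have "(d j)\<^sup>2 = 1" for j by (simp add: d_def)
      then show ?thesis unfolding onb_norm_squared[OF x] by (simp add: Dx power_mult_distrib)
    qed
    then show ?thesis by simp
  qed
  moreover have "(1 - t) *\<^sub>R (W *v v) = - (t *\<^sub>R (D *v v))" using tv by (simp add: eq_neg_iff_add_eq_0)
  then have "(1 - t) * norm (W *v v) = t * norm (D *v v)"
    using t by (metis abs_of_nonneg diff_ge_0_iff_ge norm_minus_cancel norm_scaleR)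
  ultimately have "t = 1/2" using v by (simp add: orthogonal_norm[OF o])
  then have DW: "D *v v = - (W *v v)"
  proof -
    have "(1/2) *\<^sub>R (W *v v + D *v v) = 0"
      using tv \<open>t = 1/2\<close> unfolding scaleR_right_distrib by simp
    then show ?thesis by (simp add: eq_neg_iff_add_eq_0 add.commute)
  qed
  have Wt: "transpose W *v x j = - x j" if "j \<in> M" for j
  proof -
    have "transpose W *v x j = (2 * c j) *\<^sub>R x j - W *v x j"
      using c[of j] by (simp add: eq_diff_eq add.commute del: transpose_matrix_vector)
    then show ?thesis using c1[of j] that by (simp add: M_def scaleR_2 del: transpose_matrix_vector)
  qed
  have zM: "x j \<bullet> v = 0" if j: "j \<in> M" for j
  proof -
    have "x j \<bullet> (W *v v) = - (x j \<bullet> v)"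
      unfolding inner_matrix_vector Wt[OF j] by simp
    then show ?thesis using Dx[of j v] j by (simp add: DW d_def)
  qed
  have "D *v v = v" by (rule onb_eqI[OF x]) (auto simp: Dx d_def zM)
  then have Wv: "W *v v = - v" using DW by (simp add: minus_equation_iff)
  have Wtv: "transpose W *v v = - v"
  proof -
    have "transpose W *v (W *v v) = v" by (rule orthogonal_transpose_cancel(1)[OF o])
    then have "- (transpose W *v v) = v" by (simp only: Wv matrix_vector_minus)
    then show ?thesis by (simp only: minus_equation_iff)
  qed
  have "x j \<bullet> v = 0" for j
  proof -
    have "2 * c j * (x j \<bullet> v) = (W *v x j + transpose W *v x j) \<bullet> v" by (simp add: c del: transpose_matrix_vector)
    also have "\<dots> = x j \<bullet> (transpose W *v v) + x j \<bullet> (W *v v)"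
      by (simp only: inner_add_left inner_matrix_vector[of "x j" W] inner_matrix_vector[of "x j" "transpose W"]
          transpose_transpose add.commute)
    finally have "2 * c j * (x j \<bullet> v) = x j \<bullet> (- v) + x j \<bullet> (- v)"
      by (simp only: Wv Wtv)
    then have "2 * ((c j + 1) * (x j \<bullet> v)) = 0"
      unfolding inner_minus_right by (simp add: distrib_right)
    then have "(c j + 1) * (x j \<bullet> v) = 0" by simp
    then show ?thesis using zM[of j] by (auto simp: M_def)
  qed
  then have "v = 0" using onb_eqI[OF x, of v 0] by simp
  then show False using v by simp
qed

text \<open>A fixed-point-free involution of \<open>M\<close> with a sign that it reverses: the index form of a complex
  structure on a space of even dimension.\<close>

lemma even_card_pairing:
  assumes "finite M" "even (card M)"
  obtains \<tau> and s :: "'a \<Rightarrow> real"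
  where "\<And>j. j \<in> M \<Longrightarrow> \<tau> j \<in> M" "\<And>j. j \<in> M \<Longrightarrow> \<tau> (\<tau> j) = j"
    "\<And>j. j \<in> M \<Longrightarrow> s (\<tau> j) = - s j" "\<And>j. s j = 1 \<or> s j = -1"
proof -
  obtain n where n: "card M = 2 * n" using assms(2) by blast
  obtain L where L: "L \<subseteq> M" "card L = n" "finite L"
    using obtain_subset_with_card_n[of n M] n by auto
  have "card (M - L) = n" using L n by (simp add: card_Diff_subset)
  then obtain h where h: "bij_betw h L (M - L)"
    using finite_same_card_bij[of L "M - L"] L assms(1) by auto
  define k where "k = inv_into L h"
  have k: "bij_betw k (M - L) L" unfolding k_def by (rule bij_betw_inv_into[OF h])
  have hL: "h j \<in> M - L" if "j \<in> L" for j using h that by (auto simp: bij_betw_def)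
  have kL: "k j \<in> L" if "j \<in> M - L" for j using k that by (auto simp: bij_betw_def)
  have kh: "k (h j) = j" if "j \<in> L" for j
    using h that unfolding k_def by (simp add: bij_betw_inv_into_left)
  have hk: "h (k j) = j" if "j \<in> M - L" for j
    using h that unfolding k_def by (simp add: bij_betw_inv_into_right)
  show ?thesis
    by (rule that[of "\<lambda>j. if j \<in> L then h j else k j" "\<lambda>j. if j \<in> L then 1 else -1"])
      (use L hL kL kh hk in auto)
qed

text \<open>Let \<open>K\<close> be the skew part of \<open>W\<close>. It commutes with the symmetric part, and orthogonality of \<open>W\<close> gives
  \<open>K\<^sup>2 = - sin\<^sup>2 \<theta>\<close> on the eigenspace for \<open>cos \<theta>\<close>. So \<open>K / sin \<theta>\<close> is a complex structure
  there, and the logarithm is \<open>\<theta>\<close> times it. On the eigenspace for \<open>-1\<close>, where \<open>K = 0\<close>, the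
  complex structure is chosen by pairing basis vectors, which is possible as their number is even.
  All angles lie in \<open>[0, \<pi>]\<close>, which makes this the shortest logarithm.\<close>

lemma SO_logarithm:
  fixes W :: "real^'p^'p"
  assumes W: "W \<in> SO"
  obtains x A where "onb x" "A \<in> so" "matrix_exp A = W"
    "(norm A)\<^sup>2 = (\<Sum>j\<in>UNIV. (arccos (x j \<bullet> (W *v x j)))\<^sup>2)"
    "\<And>j. -1 \<le> x j \<bullet> (W *v x j)" "\<And>j. x j \<bullet> (W *v x j) \<le> 1"
proof -
  have o: "orthogonal_matrix W" using W by (simp add: SO_def)
  obtain x c where x: "onb x" and c: "\<And>j. W *v x j + transpose W *v x j = (2 * c j) *\<^sub>R x j"
    and cj: "\<And>j. c j = x j \<bullet> (W *v x j)"
    using orthogonal_symmetric_part_onb by blast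
  define K where "K = (1/2) *\<^sub>R (W - transpose W)"
  have K: "K *v v = (1/2) *\<^sub>R (W *v v - transpose W *v v)" for v
    unfolding K_def scaleR_matrix_vector_assoc[symmetric] matrix_vector_mult_diff_rdistrib ..
  have "K \<in> so" unfolding so_def K_def by (simp add: vec_eq_iff transpose_def field_simps)
  note Kin = so_inner[OF this]
  have cabs: "\<bar>c j\<bar> \<le> 1" for j
    using Cauchy_Schwarz_ineq2[of "x j" "W *v x j"] onb_norm[OF x] orthogonal_norm[OF o] by (simp add: cj)
  have WK: "W *v x j = c j *\<^sub>R x j + K *v x j" for j
  proof -
    have "2 *\<^sub>R (W *v x j) = (W *v x j + transpose W *v x j) + (W *v x j - transpose W *v x j)"
      by (simp add: scaleR_2)
    also have "\<dots> = 2 *\<^sub>R (c j *\<^sub>R x j + K *v x j)" unfolding c K by (simp add: scaleR_right_distrib)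
    finally show ?thesis by (simp only: scaleR_cancel_left) simp
  qed
  have WtK: "transpose W *v x j = c j *\<^sub>R x j - K *v x j" for j
  proof -
    have "transpose W *v x j = (c j *\<^sub>R x j + c j *\<^sub>R x j) - W *v x j"
      using c[of j] unfolding mult_2 scaleR_add_left by (simp add: eq_diff_eq add.commute del: transpose_matrix_vector)
    then show ?thesis by (simp add: WK del: transpose_matrix_vector)
  qed
  have WKx: "W *v (K *v x j) = c j *\<^sub>R (W *v x j) - x j" for j
    proof -
      have "x j = W *v (c j *\<^sub>R x j - K *v x j)"
        unfolding WtK[symmetric] by (rule orthogonal_transpose_cancel(2)[OF o, symmetric])
      also have "\<dots> = c j *\<^sub>R (W *v x j) - W *v (K *v x j)"
        by (simp only: matrix_vector_mult_diff_distrib matrix_vector_mult_scaleR)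
      finally show ?thesis by (simp add: algebra_simps)
    qed
    have WtKx: "transpose W *v (K *v x j) = x j - c j *\<^sub>R (transpose W *v x j)" for j
    proof -
      have "x j = transpose W *v (c j *\<^sub>R x j + K *v x j)"
        unfolding WK[symmetric] by (rule orthogonal_transpose_cancel(1)[OF o, symmetric])
      also have "\<dots> = c j *\<^sub>R (transpose W *v x j) + transpose W *v (K *v x j)"
        by (simp only: matrix_vector_right_distrib matrix_vector_mult_scaleR)
      finally show ?thesis by (simp add: algebra_simps)
    qed
  have KK: "K *v (K *v x j) = - (1 - (c j)\<^sup>2) *\<^sub>R x j" for j
  proof -
    have "K *v (K *v x j) = (1/2) *\<^sub>R (c j *\<^sub>R (W *v x j + transpose W *v x j) - 2 *\<^sub>R x j)"
      unfolding K[of "K *v x j"] WKx WtKx by (simp add: algebra_simps scaleR_2 del: transpose_matrix_vector)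
    then show ?thesis unfolding c by (simp add: algebra_simps power2_eq_square)
  qed
  have nK: "(norm (K *v x j))\<^sup>2 = 1 - (c j)\<^sup>2" for j
    using Kin[of "x j" "K *v x j"] onb_norm[OF x, of j] unfolding KK power2_norm_eq_inner
    by (simp add: norm_eq_1)
  have K0: "K *v x j = 0" if "(c j)\<^sup>2 = 1" for j using nK[of j] that by simp
  \<comment> \<open>\<open>K\<close> commutes with the symmetric part, so it preserves the eigenspaces of the latter.\<close>
  have Korth: "x i \<bullet> (K *v x j) = 0" if "c i \<noteq> c j" for i j
  proof -
    have "2 * c i * (x i \<bullet> (K *v x j)) = (W *v x i + transpose W *v x i) \<bullet> (K *v x j)"
      unfolding c by simp
    also have "\<dots> = x i \<bullet> (transpose W *v (K *v x j)) + x i \<bullet> (W *v (K *v x j))"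
      by (simp only: inner_add_left inner_matrix_vector[of "x i" W] inner_matrix_vector[of "x i" "transpose W"]
          transpose_transpose add.commute)
    also have "\<dots> = x i \<bullet> (c j *\<^sub>R (W *v x j - transpose W *v x j))"
      unfolding WKx WtKx by (simp add: inner_simps algebra_simps del: transpose_matrix_vector)
    also have "\<dots> = 2 * c j * (x i \<bullet> (K *v x j))"
      unfolding K by (simp add: inner_simps del: transpose_matrix_vector)
    finally show ?thesis using that by simp
  qed
  define M where "M = {j. c j = -1}"
  have "even (card M)"
    unfolding M_def by (rule SO_even_eigenvalue_minus_one[OF W x c]) (simp add: WK K0)
  then obtain \<tau> and s :: "'p \<Rightarrow> real" where \<tau>: "\<And>j. j \<in> M \<Longrightarrow> \<tau> j \<in> M" "\<And>j. j \<in> M \<Longrightarrow> \<tau> (\<tau> j) = j"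
    and s: "\<And>j. j \<in> M \<Longrightarrow> s (\<tau> j) = - s j" "\<And>j. s j = 1 \<or> s j = -1"
    using even_card_pairing[of M] by (metis finite)
  define \<theta> where "\<theta> j = arccos (c j)" for j
  have cos\<theta>: "cos (\<theta> j) = c j" for j unfolding \<theta>_def using cabs[of j] by (intro cos_arccos_abs)
  \<comment> \<open>At \<open>\<theta> j = 0\<close> and \<open>\<theta> j = \<pi>\<close> the division by zero gives \<open>g j = 0\<close>, in accordance with \<open>K *v x j = 0\<close>.\<close>
  define g where "g j = \<theta> j / sin (\<theta> j)" for j
  have gsin: "(g j)\<^sup>2 * (1 - (c j)\<^sup>2) = (\<theta> j)\<^sup>2" if "c j \<noteq> -1" for j
  proof (cases "c j = 1")
    case True
    then show ?thesis by (simp add: \<theta>_def)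
  next
    case False
    then have "-1 < c j" "c j < 1" using that cabs[of j] by linarith+
    then have "0 < sin (\<theta> j)"
      unfolding \<theta>_def by (intro sin_gt_zero) (use arccos_lt_bounded[of "c j"] in auto)
    moreover have "1 - (c j)\<^sup>2 = (sin (\<theta> j))\<^sup>2" by (simp add: cos\<theta>[symmetric] sin_squared_eq)
    ultimately show ?thesis by (simp add: g_def power_divide)
  qed
  define y where "y j = (if j \<in> M then (pi * s j) *\<^sub>R x (\<tau> j) else g j *\<^sub>R (K *v x j))" for j
  obtain A where A: "\<And>j. A *v x j = y j" using onb_matrix_exists[OF x, of y] by metis
  have KM: "K *v x j = 0" if "j \<in> M" for j using K0 that by (simp add: M_def)
  have anti: "x i \<bullet> y j = - (x j \<bullet> y i)" for i j
  proof -
    consider "i \<in> M" "j \<in> M" | "i \<in> M" "j \<notin> M" | "i \<notin> M" "j \<in> M" | "i \<notin> M" "j \<notin> M" by blast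
    then show ?thesis
    proof cases
      case 1
      have "i = \<tau> j \<longleftrightarrow> j = \<tau> i" using \<tau>(2) 1 by metis
      then show ?thesis using 1 s(1) by (auto simp: y_def onb_inner[OF x])
    next
      case 2
      then have "x j \<bullet> x (\<tau> i) = 0" using \<tau>(1)[of i] onb_inner[OF x] by auto
      then show ?thesis using 2 Kin[of "x i" "x j"] by (simp add: y_def KM)
    next
      case 3
      then have "x i \<bullet> x (\<tau> j) = 0" using \<tau>(1)[of j] onb_inner[OF x] by auto
      then show ?thesis using 3 Kin[of "x j" "x i"] by (simp add: y_def KM)
    next
      case 4
      show ?thesis
      proof (cases "c i = c j")
        case True
        then have "g i = g j" by (simp add: g_def \<theta>_def)
        then show ?thesis using 4 Kin[of "x i" "x j"] by (simp add: y_def inner_commute)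
      next
        case False
        then show ?thesis using 4 Korth[of i j] Korth[of j i] by (simp add: y_def)
      qed
    qed
  qed
  have Aso: "A \<in> so"
  proof -
    have "transpose A *v x j = (- A) *v x j" for j
    proof (rule onb_eqI[OF x])
      fix i
      have "x i \<bullet> (transpose A *v x j) = x j \<bullet> y i"
        by (simp only: inner_matrix_vector[of "x i" "transpose A"] transpose_transpose A inner_commute)
      also have "\<dots> = x i \<bullet> ((- A) *v x j)"
        using anti[of j i] by (simp add: minus_matrix_vector A)
      finally show "x i \<bullet> (transpose A *v x j) = x i \<bullet> ((- A) *v x j)" .
    qed
    then show ?thesis unfolding so_def using onb_matrix_eqI[OF x] by blast
  qed
  \<comment> \<open>The vector \<open>K *v x j\<close> need not be a basis vector, but it lies in the eigenspace of \<open>x j\<close>, on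
    which \<open>A\<close> is \<open>g j\<close> times \<open>K\<close>.\<close>
  have AK: "A *v (K *v x j) = g j *\<^sub>R (K *v (K *v x j))" if j: "j \<notin> M" for j
  proof -
    have "(x i \<bullet> (K *v x j)) *\<^sub>R (A *v x i) = (x i \<bullet> (K *v x j)) *\<^sub>R (g j *\<^sub>R (K *v x i))" for i
    proof (cases "c i = c j")
      case True
      then have "i \<notin> M" "g i = g j" using j by (auto simp: M_def g_def \<theta>_def)
      then show ?thesis by (simp add: A y_def)
    qed (simp add: Korth)
    then have "A *v (K *v x j) = (\<Sum>i\<in>UNIV. (x i \<bullet> (K *v x j)) *\<^sub>R (g j *\<^sub>R (K *v x i)))"
      by (simp add: onb_matrix_vector[OF x, of A "K *v x j"])
    also have "\<dots> = g j *\<^sub>R (K *v (K *v x j))"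
      by (simp add: onb_matrix_vector[OF x, of K "K *v x j"] scaleR_sum_right mult.commute)
    finally show ?thesis .
  qed
  have AA: "A *v (A *v x j) = - ((\<theta> j)\<^sup>2) *\<^sub>R x j" for j
  proof (cases "j \<in> M")
    case True
    have "s j * s j = 1" using s(2)[of j] by auto
    then have "A *v (A *v x j) = - (pi\<^sup>2) *\<^sub>R x j"
      using True \<tau> s(1) by (simp add: A y_def matrix_vector_mult_scaleR power2_eq_square mult_ac)
    then show ?thesis using True by (simp add: M_def \<theta>_def)
  next
    case False
    have "A *v (A *v x j) = (g j)\<^sup>2 *\<^sub>R (K *v (K *v x j))"
      using False by (simp add: A y_def matrix_vector_mult_scaleR AK power2_eq_square)
    also have "\<dots> = - ((g j)\<^sup>2 * (1 - (c j)\<^sup>2)) *\<^sub>R x j" by (simp only: KK scaleR_scaleR mult_minus_right)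
    also have "\<dots> = - ((\<theta> j)\<^sup>2) *\<^sub>R x j" using gsin[of j] False by (simp add: M_def)
    finally show ?thesis .
  qed
  have "matrix_exp A *v x j = W *v x j" for j
  proof -
    have E: "matrix_exp A *v x j = c j *\<^sub>R x j + sinc (\<theta> j) *\<^sub>R (A *v x j)"
      using matrix_exp_plane[OF AA] by (simp add: cos\<theta>)
    have "sinc (\<theta> j) *\<^sub>R (A *v x j) = K *v x j"
    proof (cases "\<bar>c j\<bar> = 1")
      case True
      then have "K *v x j = 0" by (intro K0) (metis power2_abs one_power2)
      moreover have "sinc (\<theta> j) = 0" if "j \<in> M" using that by (simp add: M_def \<theta>_def sinc_def)
      ultimately show ?thesis by (cases "j \<in> M") (simp_all add: A y_def)
    next
      case False
      then have "-1 < c j" "c j < 1" "j \<notin> M" using cabs[of j] by (auto simp: M_def)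
      then have "0 < \<theta> j" "\<theta> j < pi" unfolding \<theta>_def using arccos_lt_bounded[of "c j"] by auto
      then have "sinc (\<theta> j) * g j = 1" using sin_gt_zero[of "\<theta> j"] by (simp add: sinc_def g_def)
      then show ?thesis using \<open>j \<notin> M\<close> by (simp add: A y_def)
    qed
    then show ?thesis by (simp add: E WK)
  qed
  then have expA: "matrix_exp A = W" by (rule onb_matrix_eqI[OF x])
  have "(norm (A *v x j))\<^sup>2 = (\<theta> j)\<^sup>2" for j
    using so_inner[OF Aso, of "x j" "A *v x j"] onb_norm[OF x, of j]
    unfolding AA power2_norm_eq_inner by (simp add: norm_eq_1)
  then have "(norm A)\<^sup>2 = (\<Sum>j\<in>UNIV. (arccos (x j \<bullet> (W *v x j)))\<^sup>2)"
    unfolding onb_frobenius[OF x] by (simp add: \<theta>_def cj)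
  moreover have "-1 \<le> x j \<bullet> (W *v x j)" "x j \<bullet> (W *v x j) \<le> 1" for j
    using cabs[of j] by (simp_all add: cj)
  ultimately show ?thesis using that x Aso expA by blast
qed

section \<open>The geodesic distance\<close>

lemma matrix_inv_orthogonal:
  fixes U :: "real^'p^'p"
  assumes "orthogonal_matrix U"
  shows "matrix_inv U = transpose U"
proof -
  have U: "U ** transpose U = mat 1" "transpose U ** U = mat 1"
    using assms by (simp_all add: orthogonal_matrix_def)
  then have "matrix_inv U ** U = mat 1"
    using someI[of "\<lambda>X. U ** X = mat 1 \<and> X ** U = mat 1" "transpose U"] by (simp add: matrix_inv_def)
  then have "matrix_inv U ** (U ** transpose U) = transpose U" by (simp add: matrix_mul_assoc)
  then show ?thesis by (simp add: U)
qed

lemma SO_matrix_inv: "U \<in> SO \<Longrightarrow> matrix_inv U = transpose U"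
  by (simp add: SO_def matrix_inv_orthogonal)

lemma SO_mult: "U \<in> SO \<Longrightarrow> V \<in> SO \<Longrightarrow> U ** V \<in> SO"
  by (simp add: SO_def orthogonal_matrix_mul det_mul)

lemma SO_transpose: "U \<in> SO \<Longrightarrow> transpose U \<in> SO"
  by (simp add: SO_def)

lemma SO_inv_mult: "U \<in> SO \<Longrightarrow> V \<in> SO \<Longrightarrow> matrix_inv U ** V \<in> SO"
  by (simp add: SO_matrix_inv SO_mult SO_transpose)

lemma d_SO_le:
  assumes "A \<in> so" "matrix_exp A = matrix_inv U ** V"
  shows "d_SO U V \<le> 1 / sqrt 2 * norm A"
  unfolding d_SO_def by (rule cInf_lower) (use assms in \<open>auto intro!: bdd_belowI[of _ 0]\<close>)

text \<open>One logarithm \<open>B\<close> has to be given because the infimum of the empty set of reals is unspecified.\<close>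

lemma d_SO_ge:
  assumes "B \<in> so" "matrix_exp B = matrix_inv U ** V"
    and "\<And>A. A \<in> so \<Longrightarrow> matrix_exp A = matrix_inv U ** V \<Longrightarrow> r \<le> 1 / sqrt 2 * norm A"
  shows "r \<le> d_SO U V"
  unfolding d_SO_def by (rule cInf_greatest) (use assms in auto)

lemma riemannian_norm: "1 / sqrt 2 * norm A = sqrt ((norm A)\<^sup>2 / 2)"
  by (simp add: real_sqrt_divide)

lemma d_SO_ge_arccos:
  fixes U V :: "real^'p^'p"
  assumes "U \<in> SO" "V \<in> SO" "onb y"
  shows "sqrt ((\<Sum>j\<in>UNIV. (arccos (y j \<bullet> ((matrix_inv U ** V) *v y j)))\<^sup>2) / 2) \<le> d_SO U V"
proof -
  obtain B where "B \<in> so" "matrix_exp B = matrix_inv U ** V"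
    using SO_logarithm[OF SO_inv_mult[OF assms(1,2)]] by metis
  then show ?thesis
    by (rule d_SO_ge) (use so_norm_ge_arccos[OF _ assms(3)] in \<open>simp only: riemannian_norm\<close>, fastforce)
qed

lemma d_SO_eq_arccos:
  fixes U V :: "real^'p^'p"
  assumes "U \<in> SO" "V \<in> SO"
  obtains x where "onb x"
    "d_SO U V = sqrt ((\<Sum>j\<in>UNIV. (arccos (x j \<bullet> ((matrix_inv U ** V) *v x j)))\<^sup>2) / 2)"
    "\<And>j. -1 \<le> x j \<bullet> ((matrix_inv U ** V) *v x j)" "\<And>j. x j \<bullet> ((matrix_inv U ** V) *v x j) \<le> 1"
proof -
  obtain x A where x: "onb x" and A: "A \<in> so" "matrix_exp A = matrix_inv U ** V"
    and n: "(norm A)\<^sup>2 = (\<Sum>j\<in>UNIV. (arccos (x j \<bullet> ((matrix_inv U ** V) *v x j)))\<^sup>2)"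
    and b: "\<And>j. -1 \<le> x j \<bullet> ((matrix_inv U ** V) *v x j)" "\<And>j. x j \<bullet> ((matrix_inv U ** V) *v x j) \<le> 1"
    using SO_logarithm[OF SO_inv_mult[OF assms]] by blast
  have "d_SO U V = sqrt ((norm A)\<^sup>2 / 2)"
    using d_SO_le[OF A] d_SO_ge_arccos[OF assms x] by (simp only: riemannian_norm n)
  then show ?thesis using that[OF x _ b] by (simp only: n)
qed

text \<open>The basis that computes the distance for \<open>W\<close> bounds it from below for \<open>W\<^sup>T\<close>, which has the same
  quadratic form.\<close>

lemma d_SO_commute:
  fixes U V :: "real^'p^'p"
  assumes "U \<in> SO" "V \<in> SO"
  shows "d_SO U V = d_SO V U"
proof -
  have "d_SO U V \<le> d_SO V U" if UV: "U \<in> SO" "V \<in> SO" for U V :: "real^'p^'p"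
  proof -
    obtain x where x: "onb x"
      and d: "d_SO U V = sqrt ((\<Sum>j\<in>UNIV. (arccos (x j \<bullet> ((matrix_inv U ** V) *v x j)))\<^sup>2) / 2)"
        by (rule d_SO_eq_arccos[OF UV])
    have T: "matrix_inv V ** U = transpose (matrix_inv U ** V)"
      using UV by (simp add: SO_matrix_inv matrix_transpose_mul)
    have "x j \<bullet> ((matrix_inv U ** V) *v x j) = x j \<bullet> ((matrix_inv V ** U) *v x j)" for j
      unfolding T inner_matrix_vector[of "x j" "matrix_inv U ** V"] by (rule inner_commute)
    then show ?thesis using d_SO_ge_arccos[OF UV(2,1) x] by (simp only: d)
  qed
  from this[OF assms] this[OF assms(2,1)] show ?thesis by (rule order_antisym)
qed

section \<open>Injectivity radius and antipodal pairs\<close>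

text \<open>The matrix \<open>v u\<^sup>T - u v\<^sup>T\<close>; for orthonormal \<open>u, v\<close> it generates the rotations of their plane, turning
  \<open>u\<close> towards \<open>v\<close>.\<close>

definition plane_generator :: "real^'p \<Rightarrow> real^'p \<Rightarrow> real^'p^'p" where
  "plane_generator u v = (\<chi> i j. v $ i * u $ j - u $ i * v $ j)"

lemma plane_generator_vector:
  "plane_generator u v *v w = (u \<bullet> w) *\<^sub>R v - (v \<bullet> w) *\<^sub>R u"
  by (simp add: plane_generator_def vec_eq_iff inner_vec_def matrix_vector_mult_def sum_distrib_left
      sum_subtractf left_diff_distrib right_diff_distrib sum_distrib_right mult_ac)

lemma plane_generator_inner:
  "plane_generator u v \<bullet> B = v \<bullet> (B *v u) - u \<bullet> (B *v v)"
  by (simp add: plane_generator_def inner_vec_def matrix_vector_mult_def sum_distrib_left sum_subtractf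
      left_diff_distrib right_diff_distrib mult_ac)

lemma plane_generator_so: "plane_generator u v \<in> so"
  by (simp add: so_def plane_generator_def vec_eq_iff transpose_def)

lemma plane_generator_norm:
  assumes uv: "norm u = 1" "norm v = 1" "u \<bullet> v = 0"
  shows "norm (plane_generator u v) = sqrt 2"
proof -
  let ?E = "plane_generator u v"
  have "?E \<bullet> ?E = 2"
    unfolding plane_generator_inner plane_generator_vector using uv by (simp add: norm_eq_1 inner_simps inner_commute)
  then show ?thesis by (simp add: norm_eq_sqrt_inner)
qed

text \<open>A skew matrix rotates \<open>x\<close> towards \<open>v = A x\<close> and \<open>v\<close> back towards \<open>x\<close>, so the entry \<open>|v|\<close> occurs twice in it.
  The inequality is Cauchy--Schwarz for \<open>A\<close> and the generator of the plane of \<open>x\<close> and \<open>v\<close>.\<close>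

lemma so_norm_ge_vector:
  fixes A :: "real^'p^'p"
  assumes A: "A \<in> so" and x: "norm x = 1"
  shows "norm (A *v x) \<le> 1 / sqrt 2 * norm A"
proof -
  define v where "v = A *v x"
  define E where "E = plane_generator x v"
  have xv: "x \<bullet> v = 0" unfolding v_def by (rule so_inner_self[OF A])
  have xx: "x \<bullet> x = 1" using x by (simp add: norm_eq_1)
  have "E \<bullet> E = 2 * (norm v)\<^sup>2"
    unfolding E_def plane_generator_inner plane_generator_vector using xv xx by (simp add: power2_norm_eq_inner inner_commute inner_simps)
  then have nE: "norm E = sqrt 2 * norm v"
    by (metis norm_eq_sqrt_inner real_sqrt_mult real_sqrt_abs abs_norm_cancel)
  have "E \<bullet> A = 2 * (norm v)\<^sup>2"
    unfolding E_def plane_generator_inner so_inner[OF A, of x v]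
    by (simp add: v_def[symmetric] power2_norm_eq_inner)
  then have "2 * (norm v)\<^sup>2 \<le> norm A * (sqrt 2 * norm v)"
    using norm_cauchy_schwarz[of E A] nE by (simp add: mult.commute)
  then have "norm v * (2 * norm v) \<le> norm v * (sqrt 2 * norm A)"
    by (simp add: power2_eq_square mult_ac)
  then have "2 * norm v \<le> sqrt 2 * norm A"
    by (cases "v = 0") auto
  moreover have "sqrt 2 * norm A = 2 * (1 / sqrt 2 * norm A)"
    by (simp add: real_div_sqrt field_simps)
  ultimately show ?thesis unfolding v_def[symmetric] by linarith
qed

text \<open>Every geodesic is minimizing up to length \<open>\<pi>\<close>: by \<open>so_norm_ge_vector\<close> its rotation angles are at most
  \<open>\<pi>\<close>, so they are recovered from their cosines, and no other logarithm can be shorter.\<close>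

lemma d_SO_exp:
  fixes U A :: "real^'p^'p"
  assumes U: "orthogonal_matrix U" and A: "A \<in> so" and le: "1 / sqrt 2 * norm A \<le> pi"
  shows "d_SO U (U ** matrix_exp A) = 1 / sqrt 2 * norm A"
proof -
  have E: "matrix_inv U ** (U ** matrix_exp A) = matrix_exp A"
    using U by (simp add: matrix_inv_orthogonal matrix_mul_assoc orthogonal_matrix_def)
  obtain x where x: "onb x" and A2: "\<And>j. A *v (A *v x j) = - ((norm (A *v x j))\<^sup>2) *\<^sub>R x j"
    using so_onb[OF A] by blast
  have inner: "x j \<bullet> (matrix_exp A *v x j) = cos (norm (A *v x j))" for j
    by (simp add: matrix_exp_plane[OF A2] inner_add_right so_inner_self[OF A] onb_inner[OF x])
  have arc: "arccos (x j \<bullet> (matrix_exp A *v x j)) = norm (A *v x j)" for j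
    unfolding inner using so_norm_ge_vector[OF A onb_norm[OF x, of j]] le
    by (intro arccos_cos) auto
  have "1 / sqrt 2 * norm A \<le> d_SO U (U ** matrix_exp A)"
  proof (rule d_SO_ge[OF A])
    fix B assume B: "B \<in> so" "matrix_exp B = matrix_inv U ** (U ** matrix_exp A)"
    then have "(norm A)\<^sup>2 \<le> (norm B)\<^sup>2"
      using so_norm_ge_arccos[OF B(1) x] by (simp add: E arc onb_frobenius[OF x, of A])
    then show "1 / sqrt 2 * norm A \<le> 1 / sqrt 2 * norm B" by (simp add: divide_right_mono)
  qed (simp add: E)
  moreover have "d_SO U (U ** matrix_exp A) \<le> 1 / sqrt 2 * norm A"
    by (rule d_SO_le[OF A]) (simp add: E)
  ultimately show ?thesis by simp
qed

text \<open>A geodesic of length less than \<open>\<pi>\<close> can be prolonged to the length \<open>\<pi>\<close> and is still minimizing, so its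
  endpoint is not a cut point.\<close>

lemma cut_locus_d_SO_ge_pi:
  fixes U V :: "real^'p^'p"
  assumes U: "orthogonal_matrix U" and V: "V \<in> cut_locus U"
  shows "pi \<le> d_SO U V"
proof (rule ccontr)
  assume "\<not> pi \<le> d_SO U V"
  then have lt: "d_SO U V < pi" by simp
  obtain A where A: "A \<in> so" and VA: "V = U ** matrix_exp A" and d: "d_SO U V = 1 / sqrt 2 * norm A"
    and cut: "\<And>t. t > 1 \<Longrightarrow> d_SO U (U ** matrix_exp (t *\<^sub>R A)) < t * (1 / sqrt 2 * norm A)"
    using V unfolding cut_locus_def by blast
  define r where "r = 1 / sqrt 2 * norm A"
  have r: "0 \<le> r" "r < pi" using lt d by (simp_all add: r_def)
  \<comment> \<open>For \<open>r = 0\<close> the geodesic is constant, and any \<open>t > 1\<close> does.\<close>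
  define t where "t = (if r = 0 then 2 else pi / r)"
  have t: "t > 1" "t * r \<le> pi" using r by (auto simp: t_def)
  have "1 / sqrt 2 * norm (t *\<^sub>R A) = t * r" using t by (simp add: r_def)
  then have "d_SO U (U ** matrix_exp (t *\<^sub>R A)) = t * r"
    using d_SO_exp[OF U so_scaleR[OF A], of t] t by simp
  then show False using cut[OF t(1)] by (simp add: r_def)
qed

text \<open>Every logarithm has to turn \<open>x\<close> into \<open>-x\<close>, that is, by an angle of at least \<open>\<pi>\<close>.\<close>

lemma d_SO_ge_pi_eigenvector:
  fixes U V :: "real^'p^'p"
  assumes "U \<in> SO" "V \<in> SO" and x: "x \<noteq> 0" "(matrix_inv U ** V) *v x = - x"
  shows "pi \<le> d_SO U V"
proof -
  obtain B where B: "B \<in> so" "matrix_exp B = matrix_inv U ** V"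
    using SO_logarithm[OF SO_inv_mult[OF assms(1,2)]] by metis
  show ?thesis
  proof (rule d_SO_ge[OF B])
    fix A assume A: "A \<in> so" "matrix_exp A = matrix_inv U ** V"
    define z where "z = x /\<^sub>R norm x"
    have z: "norm z = 1" using x by (simp add: z_def)
    have "matrix_exp A *v z = - z" unfolding A z_def by (simp add: matrix_vector_mult_scaleR x)
    then have "pi\<^sup>2 \<le> (norm (A *v z))\<^sup>2"
      using arccos_exp_le[OF A(1) z] z by (simp add: norm_eq_1)
    then have "pi \<le> norm (A *v z)" by (rule power2_le_imp_le) simp
    then show "pi \<le> 1 / sqrt 2 * norm A" using so_norm_ge_vector[OF A(1) z] by linarith
  qed
qed

text \<open>An involution \<open>R\<close> maps each \<open>v - R v\<close> to its negative, so it has the eigenvalue \<open>-1\<close>.\<close>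

lemma antipodal_d_SO_ge_pi:
  fixes U V :: "real^'p^'p"
  assumes UV: "U \<in> SO" "V \<in> SO" and "geodesically_antipodal U V \<or> involution (matrix_inv V ** U)"
  shows "pi \<le> d_SO U V"
proof -
  consider "V \<in> cut_locus U" | "U \<in> cut_locus V" | "involution (matrix_inv V ** U)"
    using assms(3) unfolding geodesically_antipodal_def by blast
  then show ?thesis
  proof cases
    case 1
    then show ?thesis using cut_locus_d_SO_ge_pi UV by (auto simp: SO_def)
  next
    case 2
    then show ?thesis
      unfolding d_SO_commute[OF UV] using cut_locus_d_SO_ge_pi UV by (auto simp: SO_def)
  next
    case 3
    let ?R = "matrix_inv V ** U"
    have R: "?R ** ?R = mat 1" "?R \<noteq> mat 1" using 3 by (auto simp: involution_def)
    then obtain v where v: "?R *v v \<noteq> v" by (metis matrix_eq matrix_vector_mul_lid)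
    have "?R *v (v - ?R *v v) = - (v - ?R *v v)"
      by (simp add: matrix_vector_mult_diff_distrib matrix_vector_mul_assoc R del: transpose_matrix_vector)
    then show ?thesis
      unfolding d_SO_commute[OF UV] using d_SO_ge_pi_eigenvector[OF UV(2,1), of "v - ?R *v v"] v by simp
  qed
qed

section \<open>Rotations at distance less than pi\<close>

text \<open>The right-hand side is the chord of the convex function \<open>arccos\<^sup>2\<close> over \<open>[-1, 1]\<close>. With \<open>t = arccos c\<close>
  the claim becomes Jordan's inequality \<open>sin (t/2) > t/\<pi>\<close>.\<close>

lemma arccos_square_less_chord:
  assumes "-1 < c" "c < 1"
  shows "(arccos c)\<^sup>2 < pi\<^sup>2 / 2 * (1 - c)"
proof -
  define t where "t = arccos c"
  have t: "0 < t" "t < pi" "cos t = c"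
    using arccos_lt_bounded[OF assms] assms by (auto simp: t_def)
  have "t / 2 * sin (pi / 2) < pi / 2 * sin (t / 2)"
    by (rule sin_ratio_strict_antimono) (use t in auto)
  then have "t\<^sup>2 < (pi * sin (t / 2))\<^sup>2" using t by (intro power_strict_mono) auto
  also have "\<dots> = pi\<^sup>2 / 2 * (1 - c)"
  proof -
    have "(sin (t / 2))\<^sup>2 = (1 - c) / 2" using cos_double_sin[of "t / 2"] t by simp
    then show ?thesis by (simp add: power_mult_distrib)
  qed
  finally show ?thesis by (simp add: t_def)
qed

lemma arccos_square_le_chord:
  assumes "-1 \<le> c" "c \<le> 1"
  shows "(arccos c)\<^sup>2 \<le> pi\<^sup>2 / 2 * (1 - c)"
  using assms arccos_square_less_chord[of c] by (cases "c = -1"; cases "c = 1") auto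

text \<open>The chord inequality bounds \<open>d\<^sup>2\<close> by \<open>\<pi>\<^sup>2/4 * (p - tr W)\<close>. Equality forces all cosines to be \<open>\<plusminus>1\<close>; then all
  basis vectors are eigenvectors of \<open>W\<close>, and \<open>W\<close> is symmetric.\<close>

lemma d_SO_less_pi:
  fixes U V :: "real^'p^'p"
  assumes UV: "U \<in> SO" "V \<in> SO"
    and tr: "real CARD('p) - trace (matrix_inv U ** V) \<le> 4"
    and strict: "real CARD('p) - trace (matrix_inv U ** V) < 4 \<or>
      transpose (matrix_inv U ** V) \<noteq> matrix_inv U ** V"
  shows "d_SO U V < pi"
proof -
  let ?W = "matrix_inv U ** V"
  have o: "orthogonal_matrix ?W" using SO_inv_mult[OF UV] by (simp add: SO_def)
  obtain x where x: "onb x"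
    and d: "d_SO U V = sqrt ((\<Sum>j\<in>UNIV. (arccos (x j \<bullet> (?W *v x j)))\<^sup>2) / 2)"
    and b: "\<And>j. -1 \<le> x j \<bullet> (?W *v x j)" "\<And>j. x j \<bullet> (?W *v x j) \<le> 1"
    by (rule d_SO_eq_arccos[OF UV]) (rule that; assumption)
  define c where "c j = x j \<bullet> (?W *v x j)" for j
  have cb: "-1 \<le> c j" "c j \<le> 1" for j using b by (simp_all add: c_def)
  have "(\<Sum>j\<in>UNIV. pi\<^sup>2 / 2 * (1 - c j)) = pi\<^sup>2 / 2 * (real CARD('p) - trace ?W)"
    unfolding sum_distrib_left[symmetric] sum_subtractf onb_trace[OF x] c_def by simp
  also have "\<dots> \<le> pi\<^sup>2 / 2 * 4" using tr by (intro mult_left_mono) auto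
  finally have chord4: "(\<Sum>j\<in>UNIV. pi\<^sup>2 / 2 * (1 - c j)) \<le> 2 * pi\<^sup>2" by simp
  have le: "(\<Sum>j\<in>UNIV. (arccos (c j))\<^sup>2) \<le> (\<Sum>j\<in>UNIV. pi\<^sup>2 / 2 * (1 - c j))"
    by (intro sum_mono arccos_square_le_chord cb)
  have "(\<Sum>j\<in>UNIV. (arccos (c j))\<^sup>2) < 2 * pi\<^sup>2"
  proof (cases "transpose ?W = ?W")
    case True
    then have "real CARD('p) - trace ?W < 4" using strict by simp
    then have "pi\<^sup>2 / 2 * (real CARD('p) - trace ?W) < pi\<^sup>2 / 2 * 4" by (intro mult_strict_left_mono) auto
    then show ?thesis
      using le \<open>_ = pi\<^sup>2 / 2 * (real CARD('p) - trace ?W)\<close> by linarith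
  next
    case False
    have "\<exists>j. (c j)\<^sup>2 \<noteq> 1"
    proof (rule ccontr)
      assume "\<not> ?thesis"
      then have c1: "c j * c j = 1" for j by (simp add: power2_eq_square)
      have eig: "?W *v x j = c j *\<^sub>R x j" for j
      proof -
        have "(?W *v x j - c j *\<^sub>R x j) \<bullet> (?W *v x j - c j *\<^sub>R x j)
            = (?W *v x j) \<bullet> (?W *v x j) - 2 * c j * (x j \<bullet> (?W *v x j)) + c j * c j * (x j \<bullet> x j)"
          by (simp add: inner_simps inner_commute algebra_simps)
        also have "(?W *v x j) \<bullet> (?W *v x j) = 1"
          using orthogonal_norm[OF o, of "x j"] onb_norm[OF x, of j] by (simp add: norm_eq_1)
        finally have "(?W *v x j - c j *\<^sub>R x j) \<bullet> (?W *v x j - c j *\<^sub>R x j) = 0"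
          using c1[of j] onb_inner[OF x, of j j] by (simp add: c_def[symmetric])
        then show ?thesis by simp
      qed
      have "transpose ?W *v x j = ?W *v x j" for j
      proof -
        have "transpose ?W *v (?W *v x j) = x j" by (rule orthogonal_transpose_cancel(1)[OF o])
        then have "c j *\<^sub>R (c j *\<^sub>R (transpose ?W *v x j)) = c j *\<^sub>R x j"
          unfolding eig by (simp only: matrix_vector_mult_scaleR)
        then show ?thesis unfolding eig by (simp only: scaleR_scaleR c1 scaleR_one)
      qed
      then show False using False onb_matrix_eqI[OF x] by blast
    qed
    then obtain k where "(c k)\<^sup>2 \<noteq> 1" by blast
    then have "c k \<noteq> -1" "c k \<noteq> 1" by auto
    then have "-1 < c k" "c k < 1" using cb[of k] by linarith+
    then have "(\<Sum>j\<in>UNIV. (arccos (c j))\<^sup>2) < (\<Sum>j\<in>UNIV. pi\<^sup>2 / 2 * (1 - c j))"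
      using arccos_square_less_chord[of "c k"]
      by (intro sum_strict_mono_ex1 ballI bexI[of _ k] arccos_square_le_chord cb) auto
    then show ?thesis using chord4 by linarith
  qed
  then have "sqrt ((\<Sum>j\<in>UNIV. (arccos (c j))\<^sup>2) / 2) < sqrt (pi\<^sup>2)" by (intro real_sqrt_less_mono) simp
  then show ?thesis by (simp add: d c_def)
qed

section \<open>Sign changes in dimension at most four\<close>

definition flip_signs :: "'p set \<Rightarrow> 'p \<Rightarrow> real" where
  "flip_signs S i = (if i \<in> S then -1 else 1)"

lemma prod_flip_signs:
  "(\<Prod>i\<in>UNIV. flip_signs S i) = (-1) ^ card (S :: 'p::finite set)"
proof -
  have "(\<Prod>i\<in>UNIV. flip_signs S i) = (\<Prod>i\<in>S. flip_signs S i) * (\<Prod>i\<in>-S. flip_signs S i)"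
    using prod.union_disjoint[of S "-S" "flip_signs S"] by (simp add: Compl_partition)
  then show ?thesis by (simp add: flip_signs_def)
qed

lemma flip_signs_even: "even (card S) \<Longrightarrow> flip_signs S \<in> even_signs"
  by (simp add: even_signs_def prod_flip_signs) (simp add: flip_signs_def)

text \<open>Even sign patterns correspond to sets of even cardinality, the positions of the negative signs.\<close>

lemma even_signs_flip:
  assumes "\<sigma> \<in> even_signs"
  obtains S where "\<sigma> = flip_signs S" "even (card S)"
proof -
  have s: "\<sigma> i = 1 \<or> \<sigma> i = -1" for i using assms by (auto simp: even_signs_def)
  have e: "\<sigma> = flip_signs {i. \<sigma> i = -1}"
    by (rule ext) (use s in \<open>auto simp: flip_signs_def\<close>)
  have "(-1 :: real) ^ card {i. \<sigma> i = -1} = 1"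
    using assms prod_flip_signs[of "{i. \<sigma> i = -1}"] by (simp add: even_signs_def flip: e)
  then have "even (card {i. \<sigma> i = -1})" by (metis minus_one_power_iff one_neq_neg_one)
  then show ?thesis using that e by blast
qed

lemma sign_change_matrix_mult_nth:
  "(sign_change_matrix \<sigma> ** R) $ i $ j = \<sigma> i * R $ i $ j"
  by (simp add: matrix_matrix_mult_def sign_change_matrix_def if_distrib[of "\<lambda>t. t * _"] cong: if_cong)

lemma sign_change_matrix_mult_vector_nth:
  "(sign_change_matrix \<sigma> *v v) $ i = \<sigma> i * v $ i"
  by (simp add: matrix_vector_mult_def sign_change_matrix_def if_distrib[of "\<lambda>t. t * _"] cong: if_cong)

lemma sign_change_matrix_transpose: "transpose (sign_change_matrix \<sigma>) = sign_change_matrix \<sigma>"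
  by (simp add: vec_eq_iff transpose_def sign_change_matrix_def)

lemma sign_change_matrix_SO:
  assumes "\<sigma> \<in> even_signs"
  shows "sign_change_matrix \<sigma> \<in> SO"
proof -
  have "\<sigma> i = 1 \<or> \<sigma> i = -1" for i using assms by (auto simp: even_signs_def)
  then have "\<sigma> i * \<sigma> i = 1" for i by (metis mult_minus_left mult_minus_right minus_minus mult_1)
  then have "sign_change_matrix \<sigma> ** sign_change_matrix \<sigma> = mat 1"
    by (simp add: vec_eq_iff sign_change_matrix_mult_nth) (simp add: sign_change_matrix_def mat_def)
  moreover have "det (sign_change_matrix \<sigma>) = 1"
    using assms by (subst det_diagonal) (auto simp: sign_change_matrix_def even_signs_def)
  ultimately show ?thesis by (simp add: SO_def orthogonal_matrix sign_change_matrix_transpose)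
qed

lemma sign_change_inv_mult:
  assumes "U \<in> SO" "\<sigma> \<in> even_signs"
  shows "matrix_inv (U ** sign_change_matrix \<sigma>) ** V = sign_change_matrix \<sigma> ** (matrix_inv U ** V)"
  using assms sign_change_matrix_SO[OF assms(2)]
  by (simp add: SO_matrix_inv SO_mult matrix_transpose_mul matrix_mul_assoc sign_change_matrix_transpose)

lemma trace_sign_change:
  "trace (sign_change_matrix \<sigma> ** R) = (\<Sum>i\<in>UNIV. \<sigma> i * R $ i $ i)"
  by (simp add: trace_def sign_change_matrix_mult_nth)

lemma exists_third_element:
  fixes i j :: "'p::finite"
  assumes "3 \<le> CARD('p)"
  obtains k where "k \<noteq> i" "k \<noteq> j"
proof -
  have "card {i, j} < CARD('p)" using assms by (simp add: card_insert_if)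
  then have "{i, j} \<noteq> UNIV" by auto
  then show ?thesis using that by blast
qed

text \<open>Otherwise all \<open>tr (I\<^sub>\<sigma>R)\<close> are at most \<open>p - 4\<close>, and \<open>I\<^sub>\<sigma>R\<close> is symmetric where equality holds. For \<open>p = 2\<close> and \<open>p = 3\<close> this is absurd,
  since this bound is negative but the traces add up to \<open>0\<close>. For \<open>p = 4\<close> they all vanish, and hence so does the
  diagonal of \<open>R\<close>; as all \<open>I\<^sub>\<sigma>R\<close> are then symmetric, \<open>R\<close> commutes with all \<open>I\<^sub>\<sigma>\<close>,
  so it is diagonal and therefore \<open>0\<close>.\<close>

lemma sign_change_small_defect:
  fixes R :: "real^'p^'p"
  assumes p: "2 \<le> CARD('p)" "CARD('p) \<le> 4" and R: "orthogonal_matrix R"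
  obtains \<sigma> where "\<sigma> \<in> even_signs"
    "real CARD('p) - trace (sign_change_matrix \<sigma> ** R) < 4 \<or>
     real CARD('p) - trace (sign_change_matrix \<sigma> ** R) = 4 \<and>
       transpose (sign_change_matrix \<sigma> ** R) \<noteq> sign_change_matrix \<sigma> ** R"
proof (rule ccontr)
  assume no: "\<not> thesis"
  let ?W = "\<lambda>S. sign_change_matrix (flip_signs S) ** R"
  let ?r = "\<lambda>i. R $ i $ i"
  note key = that
  have le: "trace (?W S) \<le> real CARD('p) - 4" if "even (card S)" for S
  proof (rule ccontr)
    assume "\<not> ?thesis"
    then have thesis by (intro key[OF flip_signs_even[OF that]]) simp
    then show False using no by blast
  qed
  have sym: "transpose (?W S) = ?W S" if "even (card S)" "trace (?W S) = real CARD('p) - 4" for S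
  proof (rule ccontr)
    assume "\<not> ?thesis"
    then have thesis using that(2) by (intro key[OF flip_signs_even[OF that(1)]]) simp
    then show False using no by blast
  qed
  have tr: "trace (?W S) = trace R - 2 * (\<Sum>i\<in>S. ?r i)" for S
  proof -
    have "trace (?W S) = (\<Sum>i\<in>UNIV. ?r i - (if i \<in> S then 2 * ?r i else 0))"
      unfolding trace_sign_change by (rule sum.cong) (auto simp: flip_signs_def)
    then show ?thesis
      by (simp add: sum_subtractf trace_def sum_distrib_left flip: sum.inter_restrict)
  qed
  have t0: "trace R \<le> real CARD('p) - 4" using le[of "{}"] by (simp add: tr)
  have t2: "trace R - 2 * (?r i + ?r k) \<le> real CARD('p) - 4" if "i \<noteq> k" for i k
    using le[of "{i, k}"] that by (simp add: tr)
  consider "CARD('p) = 2" | "CARD('p) = 3" | "CARD('p) = 4" using p by linarith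
  then show False
  proof cases
    case 1
    then obtain a b :: 'p where "UNIV = {a, b}" "a \<noteq> b" by (auto simp: card_2_iff)
    then have "trace R = (\<Sum>i\<in>{a, b}. ?r i)" unfolding trace_def by simp
    then show False using t0 t2[OF \<open>a \<noteq> b\<close>] 1 \<open>a \<noteq> b\<close> by simp
  next
    case 2
    then obtain a b c :: 'p where abc: "UNIV = {a, b, c}" "a \<noteq> b" "b \<noteq> c" "a \<noteq> c" by (auto simp: card_3_iff)
    then have "trace R = (\<Sum>i\<in>{a, b, c}. ?r i)" unfolding trace_def by simp
    then show False using t0 t2[OF abc(2)] t2[OF abc(3)] t2[OF abc(4)] 2 abc(2-4) by simp
  next
    case 3
    then obtain a :: 'p and B where aB: "UNIV = insert a B" "a \<notin> B" "card B = 3"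
      using card_Suc_eq[of "UNIV :: 'p set" 3] by auto
    then obtain b c d where "B = {b, c, d}" "b \<noteq> c" "c \<noteq> d" "b \<noteq> d" by (auto simp: card_3_iff)
    then have abcd: "UNIV = {a, b, c, d}" and dist: "distinct [a, b, c, d]" using aB by auto
    have "trace R = (\<Sum>i\<in>{a, b, c, d}. ?r i)" unfolding trace_def abcd by simp
    then have T: "trace R = ?r a + ?r b + ?r c + ?r d" using dist by simp
    have "trace R - 2 * trace R \<le> 0"
      using le[of UNIV] 3 unfolding tr trace_def[of R] by simp
    then have R0: "trace R = 0" using t0 3 by simp
    have pair: "?r i + ?r k \<ge> 0" if "i \<noteq> k" for i k using t2[OF that] R0 3 by simp
    \<comment> \<open>Complementary pairs add up to the trace, which is \<open>0\<close>.\<close>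
    have pair0: "?r i + ?r k = 0" if "i \<noteq> k" for i k
    proof -
      have "i \<in> {a, b, c, d}" "k \<in> {a, b, c, d}" using abcd by blast+
      then show ?thesis
        using that dist R0 T pair[of a b] pair[of a c] pair[of a d] pair[of b c] pair[of b d] pair[of c d]
        by auto
    qed
    have "R $ i $ j = 0" for i j
    proof -
      obtain k where k: "k \<noteq> i" "k \<noteq> j" using exists_third_element[of i j] 3 by auto
      show ?thesis
      proof (cases "i = j")
        case True
        obtain l where l: "l \<noteq> i" "l \<noteq> k" using exists_third_element[of i k] 3 by auto
        show ?thesis using pair0[of i k] pair0[of i l] pair0[of k l] k l True by simp
      next
        case False
        have "transpose R = R"
          using sym[of "{}"] 3 R0 by (simp add: tr) (simp add: vec_eq_iff sign_change_matrix_mult_nth flip_signs_def transpose_def)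
        then have "R $ j $ i = R $ i $ j" by (simp add: vec_eq_iff transpose_def)
        moreover have "transpose (?W {i, k}) = ?W {i, k}"
          using k 3 R0 pair0[of i k] by (intro sym) (auto simp: tr)
        then have "transpose (?W {i, k}) $ i $ j = ?W {i, k} $ i $ j" by simp
        then have "R $ j $ i = - R $ i $ j"
          using k False by (simp add: transpose_def sign_change_matrix_mult_nth flip_signs_def)
        ultimately show ?thesis by simp
      qed
    qed
    then have "R = 0" by (simp add: vec_eq_iff)
    then have "det R = 0" by (simp add: det_0 flip: mat_0)
    then show False using R det_orthogonal_matrix by fastforce
  qed
qed

section \<open>Tangent bounds for the distance\<close>

lemma arccos_ge_tangent:
  assumes "0 < t" "t < pi" "-1 \<le> c" "c \<le> 1"
  shows "(t\<^sup>2 + 2 * t / sin t * cos t) - 2 * t / sin t * c \<le> (arccos c)\<^sup>2"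
proof -
  define k where "k = 2 * t / sin t"
  have "t\<^sup>2 + k * (cos t - c) \<le> (arccos c)\<^sup>2"
    using square_ge_tangent[of t "arccos c"] assms arccos_lbound by (simp add: k_def)
  then show ?thesis unfolding k_def[symmetric] by (simp add: algebra_simps)
qed

text \<open>The tangents at \<open>\<pi>/2\<close> and at \<open>3\<pi>/4\<close> are those needed below. The latter is close to the angle
  \<open>\<pi>/\<surd>2\<close> that is critical for two negative signs.\<close>

lemma arccos_ge_tangent_right_angle:
  assumes "-1 \<le> c" "c \<le> 1"
  shows "pi\<^sup>2 / 4 - pi * c \<le> (arccos c)\<^sup>2"
  using arccos_ge_tangent[OF _ _ assms, of "pi / 2"] by (simp add: power_divide)

lemma arccos_ge_tangent_three_quarters:
  assumes "-1 \<le> c" "c \<le> 1"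
  shows "(9 * pi\<^sup>2 / 16 - 3 * pi / 2) - 3 * sqrt 2 / 2 * pi * c \<le> (arccos c)\<^sup>2"
proof -
  have e: "3 * pi / 4 = pi - pi / 4" by simp
  have s: "sin (3 * pi / 4) = sqrt 2 / 2" and co: "cos (3 * pi / 4) = - sqrt 2 / 2"
    unfolding e sin_diff cos_diff by (simp_all add: sin_45 cos_45)
  have k: "2 * (3 * pi / 4) / sin (3 * pi / 4) = 3 * sqrt 2 / 2 * pi"
    unfolding s by (simp add: field_simps)
  have "(3 * pi / 4)\<^sup>2 + 3 * sqrt 2 / 2 * pi * (- sqrt 2 / 2) = 9 * pi\<^sup>2 / 16 - 3 * pi / 2"
    by (simp add: power2_eq_square field_simps)
  moreover have "((3 * pi / 4)\<^sup>2 + 3 * sqrt 2 / 2 * pi * (- sqrt 2 / 2)) - 3 * sqrt 2 / 2 * pi * c \<le> (arccos c)\<^sup>2"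
    using arccos_ge_tangent[OF _ _ assms, of "3 * pi / 4"] unfolding k unfolding co by simp
  ultimately show ?thesis by simp
qed

text \<open>A linear lower bound for \<open>arccos\<^sup>2\<close> turns the sum over the basis into a trace. It would lose too much on the
  vectors fixed by \<open>W\<close>, so it is used only on the others, of which there are at most \<open>q\<close>; enlarging
  their number to \<open>q\<close> is harmless because the linear bound is at most \<open>0\<close> at \<open>c = 1\<close>.\<close>

lemma arccos_sum_ge:
  fixes W :: "real^'p^'p"
  assumes x: "onb x" and W: "orthogonal_matrix W"
    and fixed: "\<And>j. j \<notin> J \<Longrightarrow> W *v x j = x j" and J: "card J \<le> q"
    and tangent: "\<And>c. -1 \<le> c \<Longrightarrow> c \<le> 1 \<Longrightarrow> a - k * c \<le> (arccos c)\<^sup>2"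
  shows "real q * (a - k) + k * (real CARD('p) - trace W) \<le> (\<Sum>j\<in>UNIV. (arccos (x j \<bullet> (W *v x j)))\<^sup>2)"
proof -
  define c where "c j = x j \<bullet> (W *v x j)" for j
  have "\<bar>c j\<bar> \<le> 1" for j
    using Cauchy_Schwarz_ineq2[of "x j" "W *v x j"] onb_norm[OF x] orthogonal_norm[OF W] by (simp add: c_def)
  then have b: "-1 \<le> c j" "c j \<le> 1" for j by (simp_all add: abs_le_iff minus_le_iff)
  have one: "c j = 1" if "j \<notin> J" for j
    using fixed[OF that] onb_inner[OF x, of j j] by (simp add: c_def)
  have "real CARD('p) - trace W = (\<Sum>j\<in>UNIV. 1 - c j)"
    by (simp add: sum_subtractf onb_trace[OF x] c_def)
  also have "\<dots> = (\<Sum>j\<in>J. 1 - c j)"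
    by (rule sum.mono_neutral_right) (auto simp: one)
  finally have t: "real CARD('p) - trace W = (\<Sum>j\<in>J. 1 - c j)" .
  have "real q * (a - k) \<le> real (card J) * (a - k)"
    using J tangent[of 1] by (intro mult_right_mono_neg) auto
  also have "real (card J) * (a - k) + k * (real CARD('p) - trace W) = (\<Sum>j\<in>J. a - k * c j)"
    unfolding t by (simp add: sum_subtractf sum_distrib_left algebra_simps)
  also have "\<dots> \<le> (\<Sum>j\<in>J. (arccos (c j))\<^sup>2)" by (intro sum_mono tangent b)
  also have "\<dots> \<le> (\<Sum>j\<in>UNIV. (arccos (c j))\<^sup>2)" by (intro sum_mono2) auto
  finally show ?thesis by (simp add: c_def)
qed

section \<open>Half turns\<close>

text \<open>The rotation by the angle \<open>t\<close> in the plane of \<open>u\<close> and \<open>v\<close>, which leaves the orthogonal complement fixed.\<close>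

lemma plane_rotation_vector:
  assumes uv: "norm u = 1" "norm v = 1" "u \<bullet> v = 0"
  shows "matrix_exp (t *\<^sub>R plane_generator u v) *v w
    = w + (cos t - 1) *\<^sub>R ((u \<bullet> w) *\<^sub>R u + (v \<bullet> w) *\<^sub>R v) + sin t *\<^sub>R ((u \<bullet> w) *\<^sub>R v - (v \<bullet> w) *\<^sub>R u)"
proof -
  let ?A = "t *\<^sub>R plane_generator u v"
  have in1: "u \<bullet> u = 1" "v \<bullet> v = 1" "u \<bullet> v = 0" "v \<bullet> u = 0"
    using uv by (simp_all add: norm_eq_1 inner_commute)
  have A: "?A *v z = t *\<^sub>R ((u \<bullet> z) *\<^sub>R v - (v \<bullet> z) *\<^sub>R u)" for z
    by (simp add: scaleR_matrix_vector_assoc[symmetric] plane_generator_vector)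
  define w0 where "w0 = w - (u \<bullet> w) *\<^sub>R u - (v \<bullet> w) *\<^sub>R v"
  have w0: "u \<bullet> w0 = 0" "v \<bullet> w0 = 0" by (simp_all add: w0_def inner_diff_right in1)
  have s: "sinc t * t = sin t" by (simp add: sinc_def)
  have "matrix_exp ?A *v w0 = cos 0 *\<^sub>R w0 + sinc 0 *\<^sub>R (?A *v w0)"
    by (rule matrix_exp_plane) (simp add: A w0)
  then have e0: "matrix_exp ?A *v w0 = w0" by (simp add: A w0)
  have "matrix_exp ?A *v u = cos t *\<^sub>R u + sinc t *\<^sub>R (?A *v u)"
    by (rule matrix_exp_plane) (simp add: A in1 power2_eq_square)
  then have eu: "matrix_exp ?A *v u = cos t *\<^sub>R u + sin t *\<^sub>R v" by (simp add: A in1 s)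
  have "matrix_exp ?A *v v = cos t *\<^sub>R v + sinc t *\<^sub>R (?A *v v)"
    by (rule matrix_exp_plane) (simp add: A in1 power2_eq_square)
  then have ev: "matrix_exp ?A *v v = cos t *\<^sub>R v - sin t *\<^sub>R u" by (simp add: A in1 s)
  have "matrix_exp ?A *v w = matrix_exp ?A *v (w0 + (u \<bullet> w) *\<^sub>R u + (v \<bullet> w) *\<^sub>R v)"
    by (simp add: w0_def)
  also have "\<dots> = w0 + (u \<bullet> w) *\<^sub>R (cos t *\<^sub>R u + sin t *\<^sub>R v) + (v \<bullet> w) *\<^sub>R (cos t *\<^sub>R v - sin t *\<^sub>R u)"
    by (simp only: matrix_vector_right_distrib matrix_vector_mult_scaleR e0 eu ev)
  finally show ?thesis by (simp add: w0_def algebra_simps)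
qed

definition half_turn :: "real^'p \<Rightarrow> real^'p \<Rightarrow> real^'p^'p" where
  "half_turn u v = matrix_exp (pi *\<^sub>R plane_generator u v)"

lemma half_turn_vector:
  assumes "norm u = 1" "norm v = 1" "u \<bullet> v = 0"
  shows "half_turn u v *v w = w - 2 *\<^sub>R ((u \<bullet> w) *\<^sub>R u + (v \<bullet> w) *\<^sub>R v)"
  unfolding half_turn_def plane_rotation_vector[OF assms] by (simp add: algebra_simps)

lemma half_turn_properties:
  assumes uv: "norm u = 1" "norm v = 1" "u \<bullet> v = 0"
  shows "half_turn u v ** half_turn u v = mat 1" "transpose (half_turn u v) = half_turn u v"
    "half_turn u v \<in> SO"
proof -
  let ?R = "half_turn u v"
  have in1: "u \<bullet> u = 1" "v \<bullet> v = 1" "u \<bullet> v = 0" "v \<bullet> u = 0"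
    using uv by (simp_all add: norm_eq_1 inner_commute)
  note R = half_turn_vector[OF uv]
  show RR: "?R ** ?R = mat 1"
    by (simp add: matrix_eq matrix_vector_mul_assoc[symmetric] R inner_simps in1 algebra_simps scaleR_2)
  show sym: "transpose ?R = ?R"
  proof -
    have "x \<bullet> (transpose ?R *v y) = x \<bullet> (?R *v y)" for x y
    proof -
      have "x \<bullet> (transpose ?R *v y) = (?R *v x) \<bullet> y"
        by (simp only: inner_matrix_vector[of x "transpose ?R"] transpose_transpose)
      also have "\<dots> = x \<bullet> (?R *v y)" unfolding R by (simp add: inner_simps inner_commute algebra_simps)
      finally show ?thesis .
    qed
    then have "transpose ?R *v y = ?R *v y" for y by (metis vector_eq_ldot)
    then show ?thesis by (simp add: matrix_eq del: transpose_matrix_vector)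
  qed
  have o: "orthogonal_matrix ?R" by (simp add: orthogonal_matrix sym RR)
  \<comment> \<open>A half turn is the square of a quarter turn, so its determinant is not negative.\<close>
  let ?S = "matrix_exp ((pi / 2) *\<^sub>R plane_generator u v)"
  have "?S ** ?S = ?R"
    by (simp add: matrix_eq matrix_vector_mul_assoc[symmetric] R plane_rotation_vector[OF uv] inner_simps in1)
      (simp add: vec_eq_iff algebra_simps)
  then have "det ?R = (det ?S)\<^sup>2" by (metis det_mul power2_eq_square)
  then have "det ?R \<ge> 0" by simp
  then have "det ?R = 1" using det_orthogonal_matrix[OF o] by auto
  then show "?R \<in> SO" using o by (simp add: SO_def)
qed

text \<open>The geodesic \<open>exp (t \<pi> E)\<close> in the plane of \<open>u\<close> and \<open>v\<close> has length \<open>\<pi>\<close> at \<open>t = 1\<close>, so up to there it is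
  minimizing.\<close>

lemma half_turn_cut_locus:
  assumes uv: "norm u = 1" "norm v = 1" "u \<bullet> v = 0"
  shows "d_SO (mat 1) (half_turn u v) = pi" "half_turn u v \<in> cut_locus (mat 1)"
proof -
  let ?E = "plane_generator u v"
  have n: "1 / sqrt 2 * norm (t *\<^sub>R ?E) = \<bar>t\<bar>" for t
    by (simp add: plane_generator_norm[OF uv])
  have so: "t *\<^sub>R ?E \<in> so" for t by (intro so_scaleR plane_generator_so)
  have inv1: "matrix_inv (mat 1 :: real^'a^'a) = mat 1"
    by (simp add: matrix_inv_orthogonal orthogonal_matrix_id)
  have d: "d_SO (mat 1) (half_turn u v) = 1 / sqrt 2 * norm (pi *\<^sub>R ?E)"
    using d_SO_exp[OF orthogonal_matrix_id so[of pi]] n[of pi] by (simp add: half_turn_def)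
  then show "d_SO (mat 1) (half_turn u v) = pi" using n[of pi] by simp
  have "d_SO (mat 1) (mat 1 ** matrix_exp (t *\<^sub>R (pi *\<^sub>R ?E))) < t * (1 / sqrt 2 * norm (pi *\<^sub>R ?E))"
    if t: "t > 1" for t
  proof -
    \<comment> \<open>Past the half turn it is shorter to rotate in the opposite direction.\<close>
    have "matrix_exp ((t * pi - 2 * pi) *\<^sub>R ?E) = matrix_exp ((t * pi) *\<^sub>R ?E)"
      by (simp add: matrix_eq plane_rotation_vector[OF uv] cos_diff sin_diff)
    then have "d_SO (mat 1) (mat 1 ** matrix_exp (t *\<^sub>R (pi *\<^sub>R ?E))) \<le> 1 / sqrt 2 * norm ((t * pi - 2 * pi) *\<^sub>R ?E)"
      by (intro d_SO_le so) (simp add: inv1)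
    also have "\<dots> = \<bar>t - 2\<bar> * pi" unfolding n by (simp add: abs_mult flip: left_diff_distrib)
    also have "\<dots> < t * pi" using t by (intro mult_strict_right_mono) auto
    also have "t * pi = t * (1 / sqrt 2 * norm (pi *\<^sub>R ?E))" unfolding n by simp
    finally show ?thesis .
  qed
  then show "half_turn u v \<in> cut_locus (mat 1)"
    unfolding cut_locus_def using d so[of pi] by (auto simp: half_turn_def intro!: exI[of _ "pi *\<^sub>R ?E"])
qed

section \<open>A half turn far from all sign changes\<close>

lemma sum_cis_double_turn:
  assumes "3 \<le> n"
  shows "(\<Sum>k<n. cis (4 * pi * real k / real n)) = 0"
proof -
  let ?z = "cis (4 * pi / real n)"
  have z: "?z \<noteq> 1"
  proof
    assume "?z = 1"
    then have "cos (4 * pi / real n) = 1" by (metis cis.simps(1) one_complex.simps(1))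
    then obtain m :: int where "4 * pi / real n = real_of_int m * 2 * pi"
      using cos_one_2pi_int by blast
    then have "2 = real_of_int m * real n" using assms by (simp add: field_simps)
    then have m: "2 = m * int n" by (metis of_int_eq_iff of_int_mult of_int_numeral of_int_of_nat_eq)
    then have "int n dvd 2" by (metis dvd_triv_right)
    then have "int n \<le> 2" by (rule zdvd_imp_le) simp
    then show False using assms by simp
  qed
  have "cis (4 * pi * real k / real n) = ?z ^ k" for k :: nat
  proof -
    have "4 * pi * real k / real n = real k * (4 * pi / real n)" by simp
    then show ?thesis by (simp only: Complex.DeMoivre)
  qed
  then have "(\<Sum>k<n. cis (4 * pi * real k / real n)) = (?z ^ n - 1) / (?z - 1)"
    using geometric_sum[OF z, of n] by simp
  moreover have "?z ^ n = 1"
  proof -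
    have "?z ^ n = cis (real n * (4 * pi / real n))" by (rule Complex.DeMoivre)
    also have "real n * (4 * pi / real n) = 2 * pi + 2 * pi" using assms by simp
    also have "cis (2 * pi + 2 * pi) = 1" by (simp only: cis_mult[symmetric] cis_2pi mult_1)
    finally show ?thesis .
  qed
  ultimately show ?thesis by simp
qed

text \<open>The first nontrivial Fourier mode: \<open>u\<close> and \<open>v\<close> are multiples of the cosine and the sine of equally spaced
  angles \<open>f i\<close>. That they are orthonormal amounts to the vanishing of the sum of \<open>cis (2 * f i)\<close>.\<close>

lemma balanced_plane:
  assumes "3 \<le> CARD('p::finite)"
  obtains u v :: "real^('p::finite)" where "norm u = 1" "norm v = 1" "u \<bullet> v = 0"
    "\<And>i. (u $ i)\<^sup>2 + (v $ i)\<^sup>2 = 2 / real CARD('p)"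
proof -
  let ?n = "real CARD('p)"
  have n: "?n > 0" by simp
  obtain e :: "'p \<Rightarrow> nat" where e: "bij_betw e UNIV {..<CARD('p)}"
    using finite_same_card_bij[of "UNIV :: 'p set" "{..<CARD('p)}"] by auto
  define f where "f i = 2 * pi * real (e i) / ?n" for i
  have "(\<Sum>i\<in>UNIV. cis (2 * f i)) = (\<Sum>i\<in>UNIV. cis (4 * pi * real (e i) / ?n))"
    by (simp add: f_def mult.assoc)
  also have "\<dots> = (\<Sum>k<CARD('p). cis (4 * pi * real k / ?n))"
    by (rule sum.reindex_bij_betw[OF e])
  also have "\<dots> = 0" by (rule sum_cis_double_turn[OF assms])
  finally have z: "(\<Sum>i\<in>UNIV. cis (2 * f i)) = 0" .
  have c0: "(\<Sum>i\<in>UNIV. cos (2 * f i)) = 0" using arg_cong[OF z, of Re] by simp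
  have s0: "(\<Sum>i\<in>UNIV. sin (2 * f i)) = 0" using arg_cong[OF z, of Im] by simp
  define u :: "real^'p" where "u = (\<chi> i. sqrt (2 / ?n) * cos (f i))"
  define v :: "real^'p" where "v = (\<chi> i. sqrt (2 / ?n) * sin (f i))"
  have sq: "sqrt (2 / ?n) * sqrt (2 / ?n) = 2 / ?n" by simp
  have "u \<bullet> u = (\<Sum>i\<in>UNIV. 1 / ?n + 1 / ?n * cos (2 * f i))"
    unfolding u_def inner_vec_def
    by (rule sum.cong[OF refl], unfold cos_double_cos) (simp add: power2_eq_square field_simps)
  then have u: "u \<bullet> u = 1" by (simp add: sum.distrib c0 flip: sum_distrib_left sum_divide_distrib)
  have "v \<bullet> v = (\<Sum>i\<in>UNIV. 1 / ?n - 1 / ?n * cos (2 * f i))"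
    unfolding v_def inner_vec_def
    by (rule sum.cong[OF refl], unfold cos_double_sin) (simp add: power2_eq_square field_simps)
  then have v: "v \<bullet> v = 1" by (simp add: sum_subtractf c0 flip: sum_distrib_left sum_divide_distrib)
  have "u \<bullet> v = (\<Sum>i\<in>UNIV. 1 / ?n * sin (2 * f i))"
    unfolding u_def v_def inner_vec_def
    by (rule sum.cong[OF refl], unfold sin_double) (simp add: field_simps)
  then have uv: "u \<bullet> v = 0" by (simp add: s0 flip: sum_distrib_left sum_divide_distrib)
  have "(u $ i)\<^sup>2 + (v $ i)\<^sup>2 = 2 / ?n" for i
    unfolding u_def v_def by (simp add: power_mult_distrib flip: add_divide_distrib distrib_left)
  then show ?thesis using that u v uv by (simp add: norm_eq_1)
qed

text \<open>The product fixes every vector that vanishes at the coordinates in \<open>S\<close> and is orthogonal to \<open>u\<close> and \<open>v\<close>. These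
  vectors form the kernel of the positive semidefinite matrix \<open>T = \<Sum>\<^sub>i\<^sub>\<in>\<^sub>S e\<^sub>i e\<^sub>i\<^sup>T + u u\<^sup>T + v v\<^sup>T\<close>, whose
  rank is at most \<open>card S + 2\<close>; an eigenbasis of \<open>T\<close> is as required.\<close>

lemma sign_change_half_turn_onb:
  fixes u v :: "real^'p"
  assumes uv: "norm u = 1" "norm v = 1" "u \<bullet> v = 0"
  obtains x J where "onb x" "card J \<le> card S + 2"
    "\<And>j. j \<notin> J \<Longrightarrow> (sign_change_matrix (flip_signs S) ** half_turn u v) *v x j = x j"
proof -
  define T :: "real^'p^'p" where
    "T = (\<chi> i j. (if i = j \<and> i \<in> S then 1 else 0) + u $ i * u $ j + v $ i * v $ j)"
  have Tw: "T *v w = (\<chi> i. if i \<in> S then w $ i else 0) + (u \<bullet> w) *\<^sub>R u + (v \<bullet> w) *\<^sub>R v" for w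
  proof -
    have "(\<Sum>j\<in>UNIV. (if i = j \<and> i \<in> S then 1 else 0) * w $ j) = (if i \<in> S then w $ i else 0)" for i
      by (cases "i \<in> S") (simp_all add: if_distrib[of "\<lambda>t. t * _"] cong: if_cong)
    moreover have "(T *v w) $ i = (\<Sum>j\<in>UNIV. (if i = j \<and> i \<in> S then 1 else 0) * w $ j)
        + (u \<bullet> w) * u $ i + (v \<bullet> w) * v $ i" for i
      unfolding T_def matrix_vector_mult_def inner_vec_def
      by (simp only: vec_lambda_beta distrib_right sum.distrib sum_distrib_right)
        (simp add: mult_ac)
    ultimately show ?thesis by (simp add: vec_eq_iff)
  qed
  have "transpose T = T" by (auto simp: T_def vec_eq_iff transpose_def mult.commute)
  then obtain x \<mu> where x: "onb x" and \<mu>: "\<And>j. T *v x j = \<mu> j *\<^sub>R x j"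
    using symmetric_matrix_onb by blast
  define J where "J = {j. \<mu> j \<noteq> 0}"
  have quad: "w \<bullet> (T *v w) = (\<Sum>i\<in>S. (w $ i)\<^sup>2) + (u \<bullet> w)\<^sup>2 + (v \<bullet> w)\<^sup>2" for w
  proof -
    have "w \<bullet> (\<chi> i. if i \<in> S then w $ i else 0) = (\<Sum>i\<in>UNIV. if i \<in> S then (w $ i)\<^sup>2 else 0)"
      unfolding inner_vec_def by (rule sum.cong) (auto simp: power2_eq_square)
    then show ?thesis unfolding Tw
      by (simp add: inner_add_right power2_eq_square inner_commute flip: sum.inter_restrict)
  qed
  have fixed: "(sign_change_matrix (flip_signs S) ** half_turn u v) *v x j = x j" if "j \<notin> J" for j
  proof -
    have "(\<Sum>i\<in>S. (x j $ i)\<^sup>2) + (u \<bullet> x j)\<^sup>2 + (v \<bullet> x j)\<^sup>2 = 0"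
      using quad[of "x j"] \<mu>[of j] that by (simp add: J_def)
    moreover have "0 \<le> (\<Sum>i\<in>S. (x j $ i)\<^sup>2)" by (simp add: sum_nonneg)
    ultimately have z: "(\<Sum>i\<in>S. (x j $ i)\<^sup>2) = 0" "(u \<bullet> x j)\<^sup>2 = 0" "(v \<bullet> x j)\<^sup>2 = 0"
      using zero_le_power2[of "u \<bullet> x j"] zero_le_power2[of "v \<bullet> x j"] by linarith+
    then have "x j $ i = 0" if "i \<in> S" for i
      using that by (simp add: sum_nonneg_eq_0_iff)
    then have "sign_change_matrix (flip_signs S) *v x j = x j"
      by (auto simp: vec_eq_iff sign_change_matrix_mult_vector_nth flip_signs_def)
    then show ?thesis
      using z by (simp add: matrix_vector_mul_assoc[symmetric] half_turn_vector[OF uv])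
  qed
  define G where "G = (\<lambda>i. axis i 1 :: real^'p) ` S \<union> {u, v}"
  have "x j \<in> span G" if "j \<in> J" for j
  proof -
    have "(\<chi> i. if i \<in> S then w $ i else 0) = (\<Sum>i\<in>S. w $ i *\<^sub>R axis i 1)" for w :: "real^'p"
      by (simp add: vec_eq_iff axis_def if_distrib[of "\<lambda>t. _ * t"] sum.delta' cong: if_cong)
    moreover have "(\<Sum>i\<in>S. x j $ i *\<^sub>R axis i 1) \<in> span G"
      by (intro span_sum span_scale span_base) (simp add: G_def)
    moreover have "(u \<bullet> x j) *\<^sub>R u \<in> span G" "(v \<bullet> x j) *\<^sub>R v \<in> span G"
      by (intro span_scale span_base; simp add: G_def)+
    ultimately have "T *v x j \<in> span G" unfolding Tw by (simp add: span_add)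
    then have "(1 / \<mu> j) *\<^sub>R (T *v x j) \<in> span G" by (rule span_scale)
    then show ?thesis using that by (simp add: \<mu> J_def)
  qed
  then have "x ` J \<subseteq> span G" by blast
  moreover have "independent (x ` J)"
    using onb_inner[OF x] by (intro pairwise_orthogonal_independent)
      (auto simp: pairwise_def orthogonal_def, metis inner_zero_left zero_neq_one)
  ultimately have "card (x ` J) \<le> card G"
    using independent_card_le_dim[of "x ` J" "span G"] dim_le_card'[of G] by (simp add: G_def)
  moreover have "card (x ` J) = card J"
  proof (rule card_image, rule inj_onI)
    fix i j assume "x i = x j"
    then show "i = j" using onb_inner[OF x, of i j] onb_inner[OF x, of i i] by (auto split: if_splits)
  qed
  moreover have "card G \<le> card S + 2"
  proof -
    have "card G \<le> card ((\<lambda>i. axis i 1 :: real^'p) ` S) + card {u, v}" unfolding G_def by (rule card_Un_le)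
    also have "\<dots> \<le> card S + 2" by (intro add_mono card_image_le) (auto simp: card_insert_if)
    finally show ?thesis .
  qed
  ultimately show ?thesis using that[OF x _ fixed, of J] by simp
qed

lemma half_turn_nth: 
  assumes "norm u = 1" "norm v = 1" "u \<bullet> v = 0"
  shows "half_turn u v $ i $ i = 1 - 2 * ((u $ i)\<^sup>2 + (v $ i)\<^sup>2)"
proof -
  have "half_turn u v $ i $ i = (half_turn u v *v axis i 1) $ i"
    by (simp add: matrix_vector_mult_basis column_def)
  then show ?thesis
    unfolding half_turn_vector[OF assms] inner_axis
    by (simp add: axis_def power2_eq_square algebra_simps)
qed

text \<open>With \<open>card S = 2m\<close> the trace deficit is \<open>4 + 4m - 16m/p\<close>, and the angles of at most \<open>2m + 2\<close> basis vectors
  have to account for it. For \<open>m \<ge> 2\<close> the tangent at \<open>\<pi>/2\<close> suffices; for \<open>m = 1\<close> the angles must be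
  close to \<open>\<pi>/\<surd>2\<close>, and the tangent at \<open>3\<pi>/4\<close> is used.\<close>

lemma d_SO_sign_change_half_turn_ge_pi:
  fixes u v :: "real^'p"
  assumes p: "11 \<le> CARD('p)" and uv: "norm u = 1" "norm v = 1" "u \<bullet> v = 0"
    and bal: "\<And>i. (u $ i)\<^sup>2 + (v $ i)\<^sup>2 = 2 / real CARD('p)"
    and S: "even (card S)" "S \<noteq> {}"
  shows "pi \<le> d_SO (sign_change_matrix (flip_signs S)) (half_turn u v)"
proof -
  let ?I = "sign_change_matrix (flip_signs S)" and ?n = "real CARD('p)"
  let ?W = "?I ** half_turn u v"
  have I: "?I \<in> SO" by (rule sign_change_matrix_SO[OF flip_signs_even[OF S(1)]])
  have R: "half_turn u v \<in> SO" by (rule half_turn_properties(3)[OF uv])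
  have inv: "matrix_inv ?I ** half_turn u v = ?W"
    using I by (simp add: SO_matrix_inv sign_change_matrix_transpose)
  obtain m where m: "card S = 2 * m" using S(1) by blast
  have "m \<ge> 1" using m S(2) by (cases m) auto
  have n: "?n \<ge> 11" using p by simp
  obtain x J where x: "onb x" and J: "card J \<le> 2 * m + 2" and fixed: "\<And>j. j \<notin> J \<Longrightarrow> ?W *v x j = x j"
    using sign_change_half_turn_onb[OF uv, of S] m by metis
  have o: "orthogonal_matrix ?W" using SO_mult[OF I R] by (simp add: SO_def)
  have "trace ?W = (\<Sum>i\<in>UNIV. flip_signs S i) * (1 - 4 / ?n)"
    unfolding trace_sign_change half_turn_nth[OF uv] bal by (simp add: sum_distrib_right)
  also have "(\<Sum>i\<in>UNIV. flip_signs S i) = (\<Sum>i\<in>UNIV. 1 - (if i \<in> S then 2 else 0))"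
    by (rule sum.cong) (auto simp: flip_signs_def)
  also have "\<dots> = ?n - 4 * real m"
    by (simp add: sum_subtractf m flip: sum.inter_restrict)
  finally have tr: "?n - trace ?W = 4 + 4 * real m - 16 * real m / ?n"
    using n by (simp add: field_simps)
  let ?sum = "\<Sum>j\<in>UNIV. (arccos (x j \<bullet> (?W *v x j)))\<^sup>2"
  have lower: "real (2 * m + 2) * (a - k) + k * (4 + 4 * real m - 16 * real m / ?n) \<le> ?sum"
    if "\<And>c. -1 \<le> c \<Longrightarrow> c \<le> 1 \<Longrightarrow> a - k * c \<le> (arccos c)\<^sup>2" for a k
    unfolding tr[symmetric] by (rule arccos_sum_ge[OF x o fixed J that])
  have m11: "16 * real m / ?n \<le> 16 * real m / 11" using n by (intro divide_left_mono) auto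
  have "2 * pi\<^sup>2 \<le> ?sum"
  proof (cases "m = 1")
    case True
    let ?k = "3 * sqrt 2 / 2"
    have s: "7 / 5 \<le> sqrt 2" by (rule real_le_rsqrt) (simp add: power2_eq_square)
    \<comment> \<open>This is where the dimension enters: \<open>28/11\<close> is the value of \<open>4 - 16/p\<close> at \<open>p = 11\<close>.\<close>
    have "21 / 10 * (28 / 11) \<le> ?k * (4 - 16 / ?n)"
      using s m11 True by (intro mult_mono) auto
    then have "2 * pi \<le> 4 * (9 * pi / 16 - 3 / 2 - ?k) + ?k * (8 - 16 / ?n)"
      using pi_gt3 by (simp add: algebra_simps)
    then have "pi * (2 * pi) \<le> pi * (4 * (9 * pi / 16 - 3 / 2 - ?k) + ?k * (8 - 16 / ?n))"
      by (intro mult_left_mono) auto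
    also have "\<dots> = 4 * ((9 * pi\<^sup>2 / 16 - 3 * pi / 2) - ?k * pi) + ?k * pi * (8 - 16 / ?n)"
      by (simp add: power2_eq_square algebra_simps)
    also have "\<dots> \<le> ?sum"
      using lower[OF arccos_ge_tangent_three_quarters] True by simp
    finally show ?thesis by (simp add: power2_eq_square)
  next
    case False
    then have m2: "m \<ge> 2" using \<open>m \<ge> 1\<close> by simp
    have "0 \<le> (real m - 3) * (pi / 2) + (2 + real m * 6 / 11)"
    proof (cases "m = 2")
      case True
      then show ?thesis using pi_less_4 by simp
    next
      case False
      then have "0 \<le> (real m - 3) * (pi / 2)" using m2 by simp
      then show ?thesis by simp
    qed
    then have "2 * pi \<le> (2 * real m + 2) * (pi / 4 - 1) + (4 + 4 * real m - 16 * real m / ?n)"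
      using m11 by (simp add: algebra_simps)
    then have "pi * (2 * pi) \<le> pi * ((2 * real m + 2) * (pi / 4 - 1) + (4 + 4 * real m - 16 * real m / ?n))"
      by (intro mult_left_mono) auto
    also have "\<dots> = (2 * real m + 2) * (pi\<^sup>2 / 4 - pi) + pi * (4 + 4 * real m - 16 * real m / ?n)"
      by (simp add: power2_eq_square algebra_simps)
    also have "\<dots> \<le> ?sum"
      using lower[OF arccos_ge_tangent_right_angle] by (simp add: add.commute)
    finally show ?thesis by (simp add: power2_eq_square)
  qed
  then have "sqrt (pi\<^sup>2) \<le> sqrt (?sum / 2)" by (intro real_sqrt_le_mono) simp
  then show ?thesis
    using d_SO_ge_arccos[OF I R x] by (simp add: inv)
qed

section \<open>Sign-change reducibility of antipodal pairs\<close>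

theorem proposition3p18:
  shows "(2 \<le> CARD('p::finite) \<and> CARD('p) \<le> 4 \<longrightarrow>
           (\<forall>U \<in> (SO :: (real^'p^'p) set). \<forall>V \<in> SO.
              geodesically_antipodal U V \<or> involution (matrix_inv V ** U) \<longrightarrow>
              sign_change_reducible U V)) \<and>
         (CARD('p) \<ge> 11 \<longrightarrow>
           (\<exists>U \<in> (SO :: (real^'p^'p) set). \<exists>V \<in> SO.
              geodesically_antipodal U V \<and> involution (matrix_inv V ** U) \<and>
              \<not> sign_change_reducible U V))"
proof (intro conjI impI ballI)
  fix U V :: "real^'p^'p"
  assume p: "2 \<le> CARD('p) \<and> CARD('p) \<le> 4" and UV: "U \<in> SO" "V \<in> SO"
    and anti: "geodesically_antipodal U V \<or> involution (matrix_inv V ** U)"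
  have R: "orthogonal_matrix (matrix_inv U ** V)" using SO_inv_mult[OF UV] by (simp add: SO_def)
  obtain \<sigma> where \<sigma>: "\<sigma> \<in> even_signs"
    and def: "real CARD('p) - trace (sign_change_matrix \<sigma> ** (matrix_inv U ** V)) < 4 \<or>
     real CARD('p) - trace (sign_change_matrix \<sigma> ** (matrix_inv U ** V)) = 4 \<and>
       transpose (sign_change_matrix \<sigma> ** (matrix_inv U ** V)) \<noteq> sign_change_matrix \<sigma> ** (matrix_inv U ** V)"
    using sign_change_small_defect[OF conjunct1[OF p] conjunct2[OF p] R] by metis
  have "d_SO (U ** sign_change_matrix \<sigma>) V < pi"
    by (rule d_SO_less_pi[OF SO_mult[OF UV(1) sign_change_matrix_SO[OF \<sigma>]] UV(2)])
      (use def in \<open>auto simp: sign_change_inv_mult[OF UV(1) \<sigma>]\<close>)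
  then have "d_SO (U ** sign_change_matrix \<sigma>) V < d_SO U V"
    using antipodal_d_SO_ge_pi[OF UV anti] by linarith
  then show "sign_change_reducible U V" using \<sigma> by (auto simp: sign_change_reducible_def)
next
  assume p: "11 \<le> CARD('p)"
  then have "3 \<le> CARD('p)" by simp
  then obtain u v :: "real^'p" where uv: "norm u = 1" "norm v = 1" "u \<bullet> v = 0"
    and bal: "\<And>i. (u $ i)\<^sup>2 + (v $ i)\<^sup>2 = 2 / real CARD('p)"
    using balanced_plane by metis
  let ?R = "half_turn u v"
  note R = half_turn_properties[OF uv]
  note d = half_turn_cut_locus[OF uv]
  have I: "(mat 1 :: real^'p^'p) \<in> SO" by (simp add: SO_def orthogonal_matrix_id)
  have "?R \<noteq> mat 1"
  proof
    assume "?R = mat 1"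
    then have "half_turn u v *v u = u" by simp
    then have "u = 0" using uv by (simp add: half_turn_vector[OF uv] norm_eq_1 inner_commute)
    then show False using uv by simp
  qed
  then have inv: "involution (matrix_inv ?R ** mat 1)"
    using R by (simp add: SO_matrix_inv involution_def)
  have "\<not> d_SO (mat 1 ** sign_change_matrix \<sigma>) ?R < d_SO (mat 1) ?R" if \<sigma>: "\<sigma> \<in> even_signs" for \<sigma>
  proof -
    obtain S where S: "\<sigma> = flip_signs S" "even (card S)" using even_signs_flip[OF \<sigma>] by blast
    show ?thesis
    proof (cases "S = {}")
      case True
      then have "sign_change_matrix \<sigma> = mat 1"
        by (simp add: S vec_eq_iff sign_change_matrix_def flip_signs_def mat_def)
      then show ?thesis by simp
    next
      case False
      then show ?thesis
        using d_SO_sign_change_half_turn_ge_pi[OF p uv bal S(2) False] by (simp add: S d(1))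
    qed
  qed
  then have "\<not> sign_change_reducible (mat 1) ?R" by (auto simp: sign_change_reducible_def)
  then show "\<exists>U \<in> (SO :: (real^'p^'p) set). \<exists>V \<in> SO.
      geodesically_antipodal U V \<and> involution (matrix_inv V ** U) \<and> \<not> sign_change_reducible U V"
    using I R(3) d(2) inv
    by (intro bexI[of _ "mat 1"] bexI[of _ ?R]) (simp_all add: geodesically_antipodal_def)
qed

end
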